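(* Let $\mathbf P$ be a cyclic CFSM protocol with communication graph $(N,E)$ and let $\beta\in E$. For each $j\in N$ let $V_j\subseteq K_j$ be a set of states such that $h_j\in V_j$ and such that whenever $p_j\xrightarrow{-b}q_j$ in $F_j$ (for some $b$), $q_j\in V_j$. Then there is an algorithm to decide whether any given family of regular sets $Q(S)\subseteq M_\beta^*$ indexed by $S\in\prod_{j\in N}V_j$ can be extended to a family of sets $Q(S)$ indexed by $S\in\prod_{j\in N}K_j$ that is consistent with respect to $\mathbf P$ and $\beta$. Moreover, if the family can be extended, then the smallest such sets $Q(S)$ are regular and can be automatically constructed.
   Context: A CFSM protocol $\mathbf P$ has a finite directed communication graph $G=(N,E)$ (edge $\xi$ has tail $-\xi$, head $+\xi$), pairwise disjoint finite message sets $M_\xi$, and for each $j\in N$ a finite state machine $F_j=(K_j,\Sigma_j,T_j,h_j)$: finite state set $K_j$, initial state $h_j$, alphabet $\Sigma_j=\{+b: b\in M_\xi,\ j=+\xi\}\cup\{-b: b\in M_\xi,\ j=-\xi\}$, transitions $T_j\subseteq K_j\times\Sigma_j\times K_j$ written $p\xrightarrow{e}q$ ($+b$ = receive, $-b$ = send). A composite state is $S=(p_j:j\in N)$; a channel content is $C=(x_\xi:\xi\in E)$, $x_\xi\in M_\xi^*$; global states are pairs $(S,C)$. A step: some machine $F_i$ takes $p_i\xrightarrow{-b}q_i$ with $b\in M_\beta$, $i=-\beta$, appending $b$ to the end of $x_\beta$; or takes $p_i\xrightarrow{+b}q_i$ with $b\in M_\beta$, $i=+\beta$, provided $x_\beta$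 begins with $b$, removing it; all else unchanged. $\vdash^*$ means reachability by finitely many steps. $\mathbf P$ is cyclic if $G$ is a directed cycle. A family $Q(S)\subseteq M_\beta^*$ indexed by all composite states is consistent with respect to $\mathbf P$ and $\beta$ if whenever $(S,(x_\xi))\vdash^*(S',(x'_\xi))$ with $x_\xi=x'_\xi=\lambda$ for all $\xi\neq\beta$ and $x_\beta\in Q(S)$, then $x'_\beta\in Q(S')$. An extension agrees with the given sets on $\prod_j V_j$; "smallest" is with respect to componentwise inclusion. *)

theory Defs
  imports Main "HOL-Library.FuncSet" "HOL-Library.Nat_Bijection"
begin

section \<open>Communicating finite state machines (CFSM protocols)\<close>

text \<open>Actions: Snd b is the send action -b, Rcv b is the receive action +b.\<close>
datatype 'm act = Snd 'm | Rcv 'm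

text \<open>A protocol: communication graph (nodes, edges with tail/head), message sets per edge,
  and for every node a finite state machine (state set, initial state, transitions).\<close>
record ('n, 'e, 'm, 's) protocol =
  pnodes :: "'n set"
  pedges :: "'e set"
  ptail  :: "'e \<Rightarrow> 'n"
  phead  :: "'e \<Rightarrow> 'n"
  pmsgs  :: "'e \<Rightarrow> 'm set"
  pstates :: "'n \<Rightarrow> 's set"
  pinit  :: "'n \<Rightarrow> 's"
  ptrans :: "'n \<Rightarrow> ('s \<times> 'm act \<times> 's) set"

definition alphabet :: "('n, 'e, 'm, 's) protocol \<Rightarrow> 'n \<Rightarrow> 'm act set" where
  "alphabet P j =
     {Rcv b | b \<xi>. \<xi> \<in> pedges P \<and> b \<in> pmsgs P \<xi> \<and> phead P \<xi> = j}
   \<union> {Snd b | b \<xi>. \<xi> \<in> pedges P \<and> b \<in> pmsgs P \<xi> \<and> ptail P \<xi> = j}"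

definition wf_protocol :: "('n, 'e, 'm, 's) protocol \<Rightarrow> bool" where
  "wf_protocol P \<longleftrightarrow>
     finite (pnodes P) \<and> finite (pedges P)
   \<and> (\<forall>\<xi>\<in>pedges P. ptail P \<xi> \<in> pnodes P \<and> phead P \<xi> \<in> pnodes P \<and> finite (pmsgs P \<xi>))
   \<and> (\<forall>\<xi>\<in>pedges P. \<forall>\<xi>'\<in>pedges P. \<xi> \<noteq> \<xi>' \<longrightarrow> pmsgs P \<xi> \<inter> pmsgs P \<xi>' = {})
   \<and> (\<forall>j\<in>pnodes P. finite (pstates P j) \<and> pinit P j \<in> pstates P j
        \<and> ptrans P j \<subseteq> pstates P j \<times> alphabet P j \<times> pstates P j)"

text \<open>The communication graph is a directed cycle: every node has exactly one outgoing and
  exactly one incoming edge, and the graph is strongly connected.\<close>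
definition cyclic :: "('n, 'e, 'm, 's) protocol \<Rightarrow> bool" where
  "cyclic P \<longleftrightarrow>
     pnodes P \<noteq> {}
   \<and> bij_betw (ptail P) (pedges P) (pnodes P)
   \<and> bij_betw (phead P) (pedges P) (pnodes P)
   \<and> (\<forall>j\<in>pnodes P. \<forall>k\<in>pnodes P.
        (j, k) \<in> {(ptail P \<xi>, phead P \<xi>) | \<xi>. \<xi> \<in> pedges P}\<^sup>*)"

text \<open>Composite states: extensional functions on the node set.\<close>
definition comp_states :: "('n, 'e, 'm, 's) protocol \<Rightarrow> ('n \<Rightarrow> 's) set" where
  "comp_states P = Pi\<^sub>E (pnodes P) (pstates P)"

text \<open>One step on global states (S, C).\<close>
inductive step :: "('n, 'e, 'm, 's) protocol
    \<Rightarrow> ('n \<Rightarrow> 's) \<times> ('e \<Rightarrow> 'm list) \<Rightarrow> ('n \<Rightarrow> 's) \<times> ('e \<Rightarrow> 'm list) \<Rightarrow> bool"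
  for P where
  send: "\<lbrakk> \<xi> \<in> pedges P; i = ptail P \<xi>; b \<in> pmsgs P \<xi>; (S i, Snd b, q) \<in> ptrans P i \<rbrakk>
         \<Longrightarrow> step P (S, C) (S(i := q), C(\<xi> := C \<xi> @ [b]))"
| recv: "\<lbrakk> \<xi> \<in> pedges P; i = phead P \<xi>; b \<in> pmsgs P \<xi>; (S i, Rcv b, q) \<in> ptrans P i;
           C \<xi> = b # w \<rbrakk>
         \<Longrightarrow> step P (S, C) (S(i := q), C(\<xi> := w))"

definition consistent ::
  "('n, 'e, 'm, 's) protocol \<Rightarrow> 'e \<Rightarrow> (('n \<Rightarrow> 's) \<Rightarrow> 'm list set) \<Rightarrow> bool" where
  "consistent P \<beta> Q \<longleftrightarrow>
     (\<forall>S C S' C'. S \<in> comp_states P \<longrightarrow> (\<forall>\<xi>. \<xi> \<noteq> \<beta> \<longrightarrow> C \<xi> = []) \<longrightarrow> C \<beta> \<in> Q S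
        \<longrightarrow> (step P)\<^sup>*\<^sup>* (S, C) (S', C') \<longrightarrow> (\<forall>\<xi>. \<xi> \<noteq> \<beta> \<longrightarrow> C' \<xi> = []) \<longrightarrow> C' \<beta> \<in> Q S')"

text \<open>Q is an extension (to all composite states) of the family Q0 given on prod_j V_j,
  consisting of subsets of M_beta^*, that is consistent w.r.t. P and beta.\<close>
definition is_extension ::
  "('n, 'e, 'm, 's) protocol \<Rightarrow> 'e \<Rightarrow> ('n \<Rightarrow> 's set) \<Rightarrow> (('n \<Rightarrow> 's) \<Rightarrow> 'm list set)
     \<Rightarrow> (('n \<Rightarrow> 's) \<Rightarrow> 'm list set) \<Rightarrow> bool" where
  "is_extension P \<beta> V Q0 Q \<longleftrightarrow>
     (\<forall>S\<in>comp_states P. Q S \<subseteq> lists (pmsgs P \<beta>))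
   \<and> (\<forall>S\<in>Pi\<^sub>E (pnodes P) V. Q S = Q0 S)
   \<and> consistent P \<beta> Q"

definition smallest_extension ::
  "('n, 'e, 'm, 's) protocol \<Rightarrow> 'e \<Rightarrow> ('n \<Rightarrow> 's set) \<Rightarrow> (('n \<Rightarrow> 's) \<Rightarrow> 'm list set)
     \<Rightarrow> (('n \<Rightarrow> 's) \<Rightarrow> 'm list set) \<Rightarrow> bool" where
  "smallest_extension P \<beta> V Q0 Q \<longleftrightarrow>
     is_extension P \<beta> V Q0 Q
   \<and> (\<forall>Q'. is_extension P \<beta> V Q0 Q' \<longrightarrow> (\<forall>S\<in>comp_states P. Q S \<subseteq> Q' S))"

text \<open>Hypotheses on the sets V_j.\<close>
definition good_V :: "('n, 'e, 'm, 's) protocol \<Rightarrow> ('n \<Rightarrow> 's set) \<Rightarrow> bool" where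
  "good_V P V \<longleftrightarrow>
     (\<forall>j\<in>pnodes P. V j \<subseteq> pstates P j \<and> pinit P j \<in> V j
        \<and> (\<forall>p b q. (p, Snd b, q) \<in> ptrans P j \<longrightarrow> q \<in> V j))"

section \<open>Finite automata and regular languages\<close>

text \<open>A nondeterministic finite automaton: (initial state, final states, transitions).\<close>
type_synonym 'a nfa = "nat \<times> nat list \<times> (nat \<times> 'a \<times> nat) list"

inductive nfa_path :: "(nat \<times> 'a \<times> nat) list \<Rightarrow> nat \<Rightarrow> 'a list \<Rightarrow> nat \<Rightarrow> bool" for \<delta> where
  nil: "nfa_path \<delta> p [] p"
| cons: "(p, a, q) \<in> set \<delta> \<Longrightarrow> nfa_path \<delta> q w r \<Longrightarrow> nfa_path \<delta> p (a # w) r"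

definition nfa_lang :: "'a nfa \<Rightarrow> 'a list set" where
  "nfa_lang A = (case A of (q0, F, \<delta>) \<Rightarrow> {w. \<exists>f\<in>set F. nfa_path \<delta> q0 w f})"

definition regular :: "'a list set \<Rightarrow> bool" where
  "regular L \<longleftrightarrow> (\<exists>A :: 'a nfa. nfa_lang A = L)"

section \<open>Computability: partial recursive functions\<close>

datatype recf = Zf | Sf | Proj nat | Cn recf "recf list" | Pr recf recf | Mn recf

inductive reval :: "recf \<Rightarrow> nat list \<Rightarrow> nat \<Rightarrow> bool"
  and reval_list :: "recf list \<Rightarrow> nat list \<Rightarrow> nat list \<Rightarrow> bool" where
  zero: "reval Zf xs 0"
| succ: "reval Sf (x # xs) (Suc x)"
| proj: "i < length xs \<Longrightarrow> reval (Proj i) xs (xs ! i)"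
| comp: "reval_list gs xs ys \<Longrightarrow> reval f ys y \<Longrightarrow> reval (Cn f gs) xs y"
| pr0: "reval f xs y \<Longrightarrow> reval (Pr f g) (0 # xs) y"
| prS: "reval (Pr f g) (n # xs) y \<Longrightarrow> reval g (n # y # xs) z \<Longrightarrow> reval (Pr f g) (Suc n # xs) z"
| mu: "reval f (n # xs) 0 \<Longrightarrow> (\<forall>m<n. \<exists>y>0. reval f (m # xs) y) \<Longrightarrow> reval (Mn f) xs n"
| lnil: "reval_list [] xs []"
| lcons: "reval f xs y \<Longrightarrow> reval_list gs xs ys \<Longrightarrow> reval_list (f # gs) xs (y # ys)"

section \<open>Finite codes of problem instances (all names are natural numbers)\<close>

text \<open>Protocol code: node list; edges (id, tail, head, messages); machines
  (node, states, initial state, transitions (p, is_send, b, q)).\<close>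
type_synonym proto_code =
  "nat list \<times> (nat \<times> nat \<times> nat \<times> nat list) list
     \<times> (nat \<times> nat list \<times> nat \<times> (nat \<times> bool \<times> nat \<times> nat) list) list"

text \<open>Family code: list of (composite state as (node, state) pairs, automaton).\<close>
type_synonym family_code = "((nat \<times> nat) list \<times> nat nfa) list"

definition decode_protocol :: "proto_code \<Rightarrow> (nat, nat, nat, nat) protocol" where
  "decode_protocol c = (case c of (ns, es, ms) \<Rightarrow>
     \<lparr> pnodes = set ns,
       pedges = set (map fst es),
       ptail = (\<lambda>e. case map_of es e of Some (t, h, m) \<Rightarrow> t | None \<Rightarrow> 0),
       phead = (\<lambda>e. case map_of es e of Some (t, h, m) \<Rightarrow> h | None \<Rightarrow> 0),
       pmsgs = (\<lambda>e. case map_of es e of Some (t, h, m) \<Rightarrow> set m | None \<Rightarrow> {}),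
       pstates = (\<lambda>j. case map_of ms j of Some (ks, h, ts) \<Rightarrow> set ks | None \<Rightarrow> {}),
       pinit = (\<lambda>j. case map_of ms j of Some (ks, h, ts) \<Rightarrow> h | None \<Rightarrow> 0),
       ptrans = (\<lambda>j. case map_of ms j of
                    Some (ks, h, ts) \<Rightarrow>
                      (\<lambda>(p, s, b, q). (p, if s then Snd b else Rcv b, q)) ` set ts
                  | None \<Rightarrow> {}) \<rparr>)"

definition decode_V :: "(nat \<times> nat list) list \<Rightarrow> nat \<Rightarrow> nat set" where
  "decode_V vs j = (case map_of vs j of Some l \<Rightarrow> set l | None \<Rightarrow> {})"

definition decode_state :: "nat set \<Rightarrow> (nat \<times> nat) list \<Rightarrow> nat \<Rightarrow> nat" where
  "decode_state N kvs j =
     (if j \<in> N then (case map_of kvs j of Some s \<Rightarrow> s | None \<Rightarrow> undefined) else undefined)"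

definition decode_family :: "nat set \<Rightarrow> family_code \<Rightarrow> (nat \<Rightarrow> nat) \<Rightarrow> nat list set" where
  "decode_family N fc S =
     (case find (\<lambda>e. decode_state N (fst e) = S) fc of Some e \<Rightarrow> nfa_lang (snd e) | None \<Rightarrow> {})"

definition covers :: "nat set \<Rightarrow> family_code \<Rightarrow> (nat \<Rightarrow> nat) set \<Rightarrow> bool" where
  "covers N fc D \<longleftrightarrow> (\<forall>S\<in>D. \<exists>e\<in>set fc. decode_state N (fst e) = S)"

subsection \<open>Explicit encoding of codes as natural numbers\<close>

definition enc_nfa :: "nat nfa \<Rightarrow> nat" where
  "enc_nfa A = (case A of (q0, F, \<delta>) \<Rightarrow>
     prod_encode (q0, prod_encode (list_encode F,
       list_encode (map (\<lambda>(p, a, q). prod_encode (p, prod_encode (a, q))) \<delta>))))"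

definition enc_protocol :: "proto_code \<Rightarrow> nat" where
  "enc_protocol c = (case c of (ns, es, ms) \<Rightarrow>
     prod_encode (list_encode ns, prod_encode (
       list_encode (map (\<lambda>(e, t, h, m). prod_encode (e, prod_encode (t, prod_encode (h, list_encode m)))) es),
       list_encode (map (\<lambda>(j, ks, h, ts). prod_encode (j, prod_encode (list_encode ks, prod_encode (h,
          list_encode (map (\<lambda>(p, s, b, q). prod_encode (p, prod_encode (of_bool s, prod_encode (b, q)))) ts)))))
         ms))))"

definition enc_V :: "(nat \<times> nat list) list \<Rightarrow> nat" where
  "enc_V vs = list_encode (map (\<lambda>(j, l). prod_encode (j, list_encode l)) vs)"

definition enc_family :: "family_code \<Rightarrow> nat" where
  "enc_family fc = list_encode (map (\<lambda>(kvs, A). prod_encode (list_encode (map prod_encode kvs), enc_nfa A)) fc)"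

definition enc_input :: "proto_code \<Rightarrow> nat \<Rightarrow> (nat \<times> nat list) list \<Rightarrow> family_code \<Rightarrow> nat" where
  "enc_input pc \<beta> vs fc = prod_encode (enc_protocol pc, prod_encode (\<beta>, prod_encode (enc_V vs, enc_family fc)))"

subsection \<open>Valid instances of the problem\<close>

definition valid_instance :: "proto_code \<Rightarrow> nat \<Rightarrow> (nat \<times> nat list) list \<Rightarrow> family_code \<Rightarrow> bool" where
  "valid_instance pc \<beta> vs fc \<longleftrightarrow>
     (let P = decode_protocol pc; V = decode_V vs; Q0 = decode_family (pnodes P) fc in
       wf_protocol P \<and> cyclic P \<and> \<beta> \<in> pedges P \<and> good_V P V
     \<and> covers (pnodes P) fc (Pi\<^sub>E (pnodes P) V)
     \<and> (\<forall>S\<in>Pi\<^sub>E (pnodes P) V. Q0 S \<subseteq> lists (pmsgs P \<beta>)))"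

end

theory Submission
  imports Defs "HOL-Library.Sublist"
begin

text \<open>
  Cut the cycle at \<open>\<beta>\<close>. On the remaining chain every computation that starts and ends with
  empty channels can be rearranged so that messages are handed over by rendezvous, executing only
  what is demanded by the next output on \<open>\<beta>\<close>. Right after such an output the last action of
  every machine that has moved is a send, so the composite state lies in \<open>\<Prod>V\<^sub>j\<close>. Hence, if an
  extension exists, the smallest one is obtained from the given sets by rendezvous and by
  receptions from \<open>\<beta>\<close> alone: it consists of the sets \<open>{x. \<exists>S\<^sub>0 u. u x \<in> Q(S\<^sub>0)}\<close>, where \<open>u\<close> ranges
  over the words that are consumed on the way from \<open>S\<^sub>0 \<in> \<Prod>V\<^sub>j\<close> to \<open>S\<close>. An extension exists
  iff on \<open>\<Prod>V\<^sub>j\<close> the given sets contain these sets and whatever one more output on \<open>\<beta>\<close> makes of them.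

  Whether \<open>x\<close> belongs to such a set depends only on the transition relations of \<open>x\<close> in the given
  automata. There are finitely many of them and they can be listed, so both conditions can be
  checked relation by relation, and the relations are the states of automata for the smallest
  extension.
\<close>

section \<open>Recursive functions\<close>

definition recursive :: "nat \<Rightarrow> (nat list \<Rightarrow> nat) \<Rightarrow> bool" where
  "recursive k f \<longleftrightarrow> (\<exists>r. \<forall>xs. length xs = k \<longrightarrow> reval r xs (f xs))"

lemma recursiveI: "(\<And>xs. length xs = k \<Longrightarrow> reval r xs (f xs)) \<Longrightarrow> recursive k f"
  unfolding recursive_def by blast

lemma recursiveE:
  assumes "recursive k f"
  obtains r where "\<And>xs. length xs = k \<Longrightarrow> reval r xs (f xs)"
  using assms unfolding recursive_def by blast

lemma recursive_nth: "i < k \<Longrightarrow> recursive k (\<lambda>xs. xs ! i)"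
  by (rule recursiveI[where r = "Proj i"]) (simp add: reval_reval_list.proj)

lemma reval_list_recursive:
  assumes "\<forall>g\<in>set gs. recursive k g"
  obtains rs where "\<And>xs. length xs = k \<Longrightarrow> reval_list rs xs (map (\<lambda>g. g xs) gs)"
proof -
  have "\<exists>rs. \<forall>xs. length xs = k \<longrightarrow> reval_list rs xs (map (\<lambda>g. g xs) gs)"
    using assms
  proof (induction gs)
    case Nil
    show ?case using reval_reval_list.lnil by auto
  next
    case (Cons g gs)
    then obtain rs where "\<forall>xs. length xs = k \<longrightarrow> reval_list rs xs (map (\<lambda>g. g xs) gs)"
      by auto
    moreover obtain r where "\<And>xs. length xs = k \<Longrightarrow> reval r xs (g xs)"
      using Cons.prems recursiveE[of k g] by auto
    ultimately show ?case
      by (intro exI[of _ "r # rs"]) (simp add: reval_reval_list.lcons)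
  qed
  then show ?thesis using that by blast
qed

lemma recursive_compose:
  assumes "recursive (length gs) f" "\<forall>g\<in>set gs. recursive k g"
  shows "recursive k (\<lambda>xs. f (map (\<lambda>g. g xs) gs))"
proof -
  obtain r where r: "\<And>ys. length ys = length gs \<Longrightarrow> reval r ys (f ys)"
    using assms(1) by (rule recursiveE) blast
  obtain rs where rs: "\<And>xs. length xs = k \<Longrightarrow> reval_list rs xs (map (\<lambda>g. g xs) gs)"
    using assms(2) by (rule reval_list_recursive) blast
  show ?thesis
    by (rule recursiveI[where r = "Cn r rs"]) (use r rs in \<open>auto intro!: reval_reval_list.comp\<close>)
qed

lemma recursive_cong:
  "recursive k f \<Longrightarrow> (\<And>xs. length xs = k \<Longrightarrow> f xs = g xs) \<Longrightarrow> recursive k g"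
  unfolding recursive_def by metis

lemma recursive_drop:
  assumes "recursive k f"
  shows "recursive (n + k) (\<lambda>ys. f (drop n ys))"
proof (rule recursive_cong)
  show "recursive (n + k) (\<lambda>ys. f (map (\<lambda>g. g ys) (map (\<lambda>i ys. ys ! (n + i)) [0..<k])))"
    by (rule recursive_compose) (auto simp: assms intro: recursive_nth)
  fix ys :: "nat list"
  assume "length ys = n + k"
  then have "map (\<lambda>i. ys ! (n + i)) [0..<k] = drop n ys"
    by (intro nth_equalityI) auto
  then show "f (map (\<lambda>g. g ys) (map (\<lambda>i ys. ys ! (n + i)) [0..<k])) = f (drop n ys)"
    by (simp add: comp_def)
qed

lemma recursive_Suc:
  assumes "recursive k f"
  shows "recursive k (\<lambda>xs. Suc (f xs))"
proof -
  have "recursive 1 (\<lambda>ys. Suc (ys ! 0))"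
    by (rule recursiveI[where r = Sf]) (auto simp: length_Suc_conv reval_reval_list.succ)
  then show ?thesis using recursive_compose[of "[f]" "\<lambda>ys. Suc (ys ! 0)" k] assms by simp
qed

lemma recursive_const: "recursive k (\<lambda>xs. c)"
proof (induction c)
  case 0
  show ?case by (rule recursiveI[where r = Zf]) (rule reval_reval_list.zero)
qed (rule recursive_Suc)

lemma reval_primitive_recursion:
  assumes "reval r xs a" "\<And>i y. reval s (i # y # xs) (h i y)"
  shows "reval (Pr r s) (n # xs) (rec_nat a h n)"
  by (induction n) (auto intro: reval_reval_list.pr0 reval_reval_list.prS assms)

lemma recursive_rec_nat:
  assumes n: "recursive k n" and f: "recursive k f"
    and h: "recursive (2 + k) (\<lambda>ys. h (ys ! 0) (ys ! 1) (drop 2 ys))"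
  shows "recursive k (\<lambda>xs. rec_nat (f xs) (\<lambda>i y. h i y xs) (n xs))"
proof -
  obtain r where r: "\<And>xs. length xs = k \<Longrightarrow> reval r xs (f xs)"
    using f by (rule recursiveE) blast
  obtain s where s: "\<And>ys. length ys = 2 + k \<Longrightarrow> reval s ys (h (ys ! 0) (ys ! 1) (drop 2 ys))"
    using h by (rule recursiveE) blast
  have "recursive (Suc k) (\<lambda>ys. rec_nat (f (tl ys)) (\<lambda>i y. h i y (tl ys)) (hd ys))"
  proof (rule recursiveI[where r = "Pr r s"])
    fix ys :: "nat list"
    assume "length ys = Suc k"
    then obtain m xs where ys: "ys = m # xs" and "length xs = k" by (auto simp: length_Suc_conv)
    then show "reval (Pr r s) ys (rec_nat (f (tl ys)) (\<lambda>i y. h i y (tl ys)) (hd ys))"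
      using r s[of "_ # _ # xs"] by (simp add: reval_primitive_recursion)
  qed
  then have "recursive k (\<lambda>xs. (\<lambda>ys. rec_nat (f (tl ys)) (\<lambda>i y. h i y (tl ys)) (hd ys))
      (map (\<lambda>g. g xs) (n # map (\<lambda>i xs. xs ! i) [0..<k])))"
    by (intro recursive_compose) (auto simp: n recursive_nth)
  then show ?thesis
  proof (rule recursive_cong)
    fix xs :: "nat list"
    assume "length xs = k"
    then have "map (\<lambda>g. g xs) (n # map (\<lambda>i xs. xs ! i) [0..<k]) = n xs # xs"
      using map_nth[of xs] by (simp add: comp_def)
    then show "(\<lambda>ys. rec_nat (f (tl ys)) (\<lambda>i y. h i y (tl ys)) (hd ys))
        (map (\<lambda>g. g xs) (n # map (\<lambda>i xs. xs ! i) [0..<k])) = rec_nat (f xs) (\<lambda>i y. h i y xs) (n xs)"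
      by simp
  qed
qed

lemma recursive_add:
  assumes "recursive k f" "recursive k g"
  shows "recursive k (\<lambda>xs. f xs + g xs)"
proof -
  have "rec_nat b (\<lambda>i y. Suc y) a = a + b" for a b by (induction a) auto
  moreover have "recursive k (\<lambda>xs. rec_nat (g xs) (\<lambda>i y. Suc y) (f xs))"
    by (intro recursive_rec_nat recursive_Suc recursive_nth assms) simp
  ultimately show ?thesis by simp
qed

lemma recursive_pred:
  assumes "recursive k f"
  shows "recursive k (\<lambda>xs. f xs - 1)"
proof -
  have "rec_nat 0 (\<lambda>i y. i) a = a - 1" for a by (cases a) auto
  moreover have "recursive k (\<lambda>xs. rec_nat 0 (\<lambda>i y. i) (f xs))"
    by (intro recursive_rec_nat recursive_const recursive_nth assms) simp
  ultimately show ?thesis by simp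
qed

lemma recursive_diff:
  assumes "recursive k f" "recursive k g"
  shows "recursive k (\<lambda>xs. f xs - g xs)"
proof -
  have "rec_nat a (\<lambda>i y. y - 1) b = a - b" for a b by (induction b) auto
  moreover have "recursive k (\<lambda>xs. rec_nat (f xs) (\<lambda>i y. y - 1) (g xs))"
    by (intro recursive_rec_nat recursive_pred recursive_nth assms) simp
  ultimately show ?thesis by simp
qed

lemma recursive_if_zero:
  assumes "recursive k c" "recursive k f" "recursive k g"
  shows "recursive k (\<lambda>xs. if c xs = 0 then f xs else g xs)"
proof -
  have "rec_nat a (\<lambda>i y. b) n = (if n = 0 then a else b)" for a b n :: nat by (cases n) auto
  moreover have "recursive k (\<lambda>xs. rec_nat (f xs) (\<lambda>i y. g xs) (c xs))"
    by (intro recursive_rec_nat recursive_drop assms)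
  ultimately show ?thesis by simp
qed

lemma recursive_triangle:
  assumes "recursive k f"
  shows "recursive k (\<lambda>xs. triangle (f xs))"
proof -
  have "rec_nat 0 (\<lambda>i y. y + Suc i) a = triangle a" for a by (induction a) auto
  moreover have "recursive k (\<lambda>xs. rec_nat 0 (\<lambda>i y. y + Suc i) (f xs))"
    by (intro recursive_rec_nat recursive_const recursive_add recursive_Suc recursive_nth assms) simp_all
  ultimately show ?thesis by simp
qed

lemma recursive_prod_encode:
  assumes "recursive k f" "recursive k g"
  shows "recursive k (\<lambda>xs. prod_encode (f xs, g xs))"
  unfolding prod_encode_def by (simp add: recursive_add recursive_triangle assms)

primrec diagonal :: "nat \<Rightarrow> nat" where
  "diagonal 0 = 0"
| "diagonal (Suc z) =
     (if triangle (Suc (diagonal z)) - Suc z = 0 then Suc (diagonal z) else diagonal z)"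

lemma triangle_diagonal_bounds: "triangle (diagonal z) \<le> z \<and> z < triangle (Suc (diagonal z))"
  by (induction z) auto

lemma triangle_less_SucD:
  assumes "triangle m < triangle (Suc n)"
  shows "m \<le> n"
proof -
  have "mono triangle" by (rule mono_iff_le_Suc[THEN iffD2]) simp
  from monoD[OF this, of "Suc n" m] assms show ?thesis by linarith
qed

lemma diagonal_prod_encode: "diagonal (prod_encode (m, n)) = m + n"
proof (rule antisym)
  let ?z = "prod_encode (m, n)"
  have z: "triangle (m + n) \<le> ?z" "?z < triangle (Suc (m + n))"
    by (simp_all add: prod_encode_def)
  show "diagonal ?z \<le> m + n" "m + n \<le> diagonal ?z"
    using z triangle_diagonal_bounds[of ?z] by (auto intro!: triangle_less_SucD simp del: triangle_Suc)
qed

lemma prod_decode_eq_diagonal: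
  "prod_decode z = (z - triangle (diagonal z), diagonal z - (z - triangle (diagonal z)))"
proof -
  obtain m n where z: "z = prod_encode (m, n)" by (metis prod_decode_inverse surj_pair)
  have "z - triangle (m + n) = m" by (simp add: z prod_encode_def)
  then show ?thesis by (simp add: z diagonal_prod_encode)
qed

lemma recursive_diagonal:
  assumes "recursive k f"
  shows "recursive k (\<lambda>xs. diagonal (f xs))"
proof -
  have "rec_nat 0 (\<lambda>i y. if triangle (Suc y) - Suc i = 0 then Suc y else y) z = diagonal z" for z
    by (induction z) auto
  moreover have "recursive k (\<lambda>xs. rec_nat 0
      (\<lambda>i y. if triangle (Suc y) - Suc i = 0 then Suc y else y) (f xs))"
    by (intro recursive_rec_nat recursive_if_zero recursive_diff recursive_triangle recursive_Suc
        recursive_const recursive_nth assms) simp_all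
  ultimately show ?thesis by simp
qed

lemma recursive_prod_decode:
  assumes "recursive k f"
  shows "recursive k (\<lambda>xs. fst (prod_decode (f xs)))" "recursive k (\<lambda>xs. snd (prod_decode (f xs)))"
  by (subst prod_decode_eq_diagonal,
      simp add: recursive_diff recursive_triangle recursive_diagonal assms)+

section \<open>Computable functions on encoded data\<close>

class encodable =
  fixes encode :: "'a \<Rightarrow> nat"
  assumes encode_eq_iff: "encode x = encode y \<longleftrightarrow> x = y"

instantiation nat :: encodable
begin
definition encode_nat :: "nat \<Rightarrow> nat" where "encode_nat n = n"
instance by standard (simp add: encode_nat_def)
end

instantiation bool :: encodable
begin
definition encode_bool :: "bool \<Rightarrow> nat" where "encode_bool b = of_bool b"
instance by standard (simp add: encode_bool_def)
end

instantiation prod :: (encodable, encodable) encodable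
begin
definition encode_prod :: "'a \<times> 'b \<Rightarrow> nat" where
  "encode_prod p = prod_encode (encode (fst p), encode (snd p))"
instance by standard (auto simp: encode_prod_def encode_eq_iff prod_eq_iff)
end

instantiation list :: (encodable) encodable
begin
definition encode_list :: "'a list \<Rightarrow> nat" where "encode_list xs = list_encode (map encode xs)"
instance by standard (simp add: encode_list_def list_encode_eq encode_eq_iff inj_map_eq_map inj_def)
end

instantiation option :: (encodable) encodable
begin
definition encode_option :: "'a option \<Rightarrow> nat" where
  "encode_option x = (case x of None \<Rightarrow> 0 | Some y \<Rightarrow> Suc (encode y))"
instance by standard (auto simp: encode_option_def encode_eq_iff split: option.splits)
end

lemma encode_Pair: "encode (x, y) = prod_encode (encode x, encode y)"
  by (simp add: encode_prod_def)

lemma encode_Nil: "encode [] = 0"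
  by (simp add: encode_list_def)

lemma encode_Cons: "encode (x # xs) = Suc (prod_encode (encode x, encode xs))"
  by (simp add: encode_list_def)

lemma length_le_encode: "length xs \<le> encode xs"
proof (induction xs)
  case (Cons x xs)
  then show ?case using le_prod_encode_2[of "encode xs" "encode x"] by (simp add: encode_Cons)
qed simp

definition computable :: "('a::encodable \<Rightarrow> 'b::encodable) \<Rightarrow> bool" where
  "computable f \<longleftrightarrow> (\<exists>g. recursive 1 (\<lambda>xs. g (xs ! 0)) \<and> (\<forall>x. g (encode x) = encode (f x)))"

lemma computableI:
  "recursive 1 (\<lambda>xs. g (xs ! 0)) \<Longrightarrow> (\<And>x. g (encode x) = encode (f x)) \<Longrightarrow> computable f"
  unfolding computable_def by blast

lemma computableE:
  assumes "computable f"
  obtains g where "\<And>k h. recursive k h \<Longrightarrow> recursive k (\<lambda>xs. g (h xs))"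
    and "\<And>x. g (encode x) = encode (f x)"
proof -
  obtain g where "recursive 1 (\<lambda>xs. g (xs ! 0))" and "\<And>x. g (encode x) = encode (f x)"
    using assms unfolding computable_def by blast
  moreover from this(1) have "recursive k (\<lambda>xs. g (h xs))" if "recursive k h" for k h
    using recursive_compose[of "[h]" "\<lambda>ys. g (ys ! 0)" k] that by simp
  ultimately show ?thesis using that by blast
qed

lemma reval_computable:
  assumes "computable f"
  obtains r where "\<And>x. reval r [encode x] (encode (f x))"
proof -
  obtain g where "recursive 1 (\<lambda>xs. g (xs ! 0))" and g: "\<And>x. g (encode x) = encode (f x)"
    using assms unfolding computable_def by blast
  from this(1) obtain r where r: "\<And>xs. length xs = 1 \<Longrightarrow> reval r xs (g (xs ! 0))"
    by (rule recursiveE) blast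
  have "reval r [encode x] (encode (f x))" for x using r[of "[encode x]"] by (simp add: g)
  then show ?thesis by (rule that)
qed

named_theorems computable_intros

lemma computable_id [computable_intros]: "computable (\<lambda>x. x)"
  by (rule computableI[of "\<lambda>n. n"]) (simp_all add: recursive_nth)

lemma computable_const [computable_intros]: "computable (\<lambda>x. c)"
  by (rule computableI[of "\<lambda>n. encode c"]) (simp_all add: recursive_const)

lemma computable_compose:
  assumes "computable f" "computable g"
  shows "computable (\<lambda>x. f (g x))"
proof -
  obtain f' where "\<And>k h. recursive k h \<Longrightarrow> recursive k (\<lambda>xs. f' (h xs))"
    and "\<And>x. f' (encode x) = encode (f x)"
    using assms(1) by (rule computableE) blast
  moreover obtain g' where "\<And>k h. recursive k h \<Longrightarrow> recursive k (\<lambda>xs. g' (h xs))"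
    and "\<And>x. g' (encode x) = encode (g x)"
    using assms(2) by (rule computableE) blast
  ultimately show ?thesis
    by (intro computableI[of "\<lambda>n. f' (g' n)"]) (simp_all add: recursive_nth)
qed

lemma computable_Pair [computable_intros]:
  assumes "computable f" "computable g"
  shows "computable (\<lambda>x. (f x, g x))"
proof -
  obtain f' where "\<And>k h. recursive k h \<Longrightarrow> recursive k (\<lambda>xs. f' (h xs))"
    and "\<And>x. f' (encode x) = encode (f x)"
    using assms(1) by (rule computableE) blast
  moreover obtain g' where "\<And>k h. recursive k h \<Longrightarrow> recursive k (\<lambda>xs. g' (h xs))"
    and "\<And>x. g' (encode x) = encode (g x)"
    using assms(2) by (rule computableE) blast
  ultimately show ?thesis
    by (intro computableI[of "\<lambda>n. prod_encode (f' n, g' n)"])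
      (simp_all add: recursive_nth recursive_prod_encode encode_Pair)
qed

lemma computable_compose2:
  assumes "computable (\<lambda>p. F (fst p) (snd p))" "computable f" "computable g"
  shows "computable (\<lambda>x. F (f x) (g x))"
  using computable_compose[OF assms(1) computable_Pair[OF assms(2,3)]] by simp

lemma computable_compose3:
  assumes "computable (\<lambda>p. F (fst p) (fst (snd p)) (snd (snd p)))"
    and "computable f" "computable g" "computable h"
  shows "computable (\<lambda>x. F (f x) (g x) (h x))"
  using computable_compose[OF assms(1) computable_Pair[OF assms(2) computable_Pair[OF assms(3,4)]]]
  by simp

lemma computable_fst [computable_intros]: "computable f \<Longrightarrow> computable (\<lambda>x. fst (f x))"
  by (rule computable_compose[of fst], rule computableI[of "\<lambda>n. fst (prod_decode n)"])
    (auto simp: encode_prod_def intro: recursive_prod_decode recursive_nth)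

lemma computable_snd [computable_intros]: "computable f \<Longrightarrow> computable (\<lambda>x. snd (f x))"
  by (rule computable_compose[of snd], rule computableI[of "\<lambda>n. snd (prod_decode n)"])
    (auto simp: encode_prod_def intro: recursive_prod_decode recursive_nth)

lemma computable_encode [computable_intros]: "computable f \<Longrightarrow> computable (\<lambda>x. encode (f x))"
  by (rule computable_compose[of encode], rule computableI[of "\<lambda>n. n"])
    (simp_all add: encode_nat_def recursive_nth)

lemma computable_Suc [computable_intros]: "computable f \<Longrightarrow> computable (\<lambda>x. Suc (f x))"
  by (rule computable_compose[of Suc], rule computableI[of Suc])
    (simp_all add: encode_nat_def recursive_Suc recursive_nth)

lemma computable_Some [computable_intros]: "computable f \<Longrightarrow> computable (\<lambda>x. Some (f x))"
  by (rule computable_compose[of Some], rule computableI[of Suc])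
    (simp_all add: encode_option_def recursive_Suc recursive_nth)

lemma computable_Cons [computable_intros]: "computable f \<Longrightarrow> computable g \<Longrightarrow> computable (\<lambda>x. f x # g x)"
  by (rule computable_compose2[of "(#)"], rule computableI[of Suc])
    (simp_all add: encode_Cons encode_prod_def recursive_Suc recursive_nth)

lemma computable_if [computable_intros]:
  "computable c \<Longrightarrow> computable f \<Longrightarrow> computable g \<Longrightarrow> computable (\<lambda>x. if c x then f x else g x)"
  by (rule computable_compose3[of "\<lambda>b. If b"], rule computableI[of "\<lambda>n. if fst (prod_decode n) = 0
        then snd (prod_decode (snd (prod_decode n))) else fst (prod_decode (snd (prod_decode n)))"])
    (simp_all add: encode_prod_def encode_bool_def recursive_if_zero recursive_prod_decode recursive_nth)

lemma computable_not [computable_intros]: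
  assumes "computable P"
  shows "computable (\<lambda>x. \<not> P x)"
proof -
  have "computable (\<lambda>x. if P x then False else True)" by (intro computable_intros assms)
  moreover have "(if P x then False else True) \<longleftrightarrow> \<not> P x" for x by simp
  ultimately show ?thesis by (simp only:)
qed

lemma computable_conj [computable_intros]:
  assumes "computable P" "computable Q"
  shows "computable (\<lambda>x. P x \<and> Q x)"
proof -
  have "computable (\<lambda>x. if P x then Q x else False)" by (intro computable_intros assms)
  moreover have "(if P x then Q x else False) \<longleftrightarrow> P x \<and> Q x" for x by simp
  ultimately show ?thesis by (simp only:)
qed

lemma computable_imp [computable_intros]:
  assumes "computable P" "computable Q"
  shows "computable (\<lambda>x. P x \<longrightarrow> Q x)"
proof -
  have "computable (\<lambda>x. \<not> (P x \<and> \<not> Q x))" by (intro computable_intros assms)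
  then show ?thesis by simp
qed

lemma computable_eq [computable_intros]:
  assumes "computable f" "computable g"
  shows "computable (\<lambda>x. f x = g x)"
proof (rule computable_compose2[OF _ assms])
  have "recursive 1 (\<lambda>xs. 1 - (fst (prod_decode (xs ! 0)) - snd (prod_decode (xs ! 0))
      + (snd (prod_decode (xs ! 0)) - fst (prod_decode (xs ! 0)))))"
    by (intro recursive_diff recursive_add recursive_const recursive_prod_decode recursive_nth) simp_all
  moreover have "1 - (m - n + (n - m)) = encode (m = n)" for m n :: nat
    by (auto simp: encode_bool_def)
  ultimately show "computable (\<lambda>p :: 'b \<times> 'b. fst p = snd p)"
    by (intro computableI[of "\<lambda>n. 1 - (fst (prod_decode n) - snd (prod_decode n)
        + (snd (prod_decode n) - fst (prod_decode n)))"])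
      (simp_all only: encode_prod_def prod_encode_inverse fst_conv snd_conv encode_eq_iff)
qed

lemma computable_case_option [computable_intros]:
  assumes "computable f" "computable g" "computable (\<lambda>p. h (fst p) (snd p))"
  shows "computable (\<lambda>x. case f x of None \<Rightarrow> g x | Some y \<Rightarrow> h x y)"
proof -
  obtain f' where f': "\<And>k h. recursive k h \<Longrightarrow> recursive k (\<lambda>xs. f' (h xs))"
    "\<And>x. f' (encode x) = encode (f x)"
    using assms(1) by (rule computableE) blast
  obtain g' where g': "\<And>k h. recursive k h \<Longrightarrow> recursive k (\<lambda>xs. g' (h xs))"
    "\<And>x. g' (encode x) = encode (g x)"
    using assms(2) by (rule computableE) blast
  obtain h' where h': "\<And>k h. recursive k h \<Longrightarrow> recursive k (\<lambda>xs. h' (h xs))"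
    "\<And>p. h' (encode p) = encode (h (fst p) (snd p))"
    using assms(3) by (rule computableE) blast
  have "h' (prod_encode (encode x, encode y)) = encode (h x y)" for x y
    using h'(2)[of "(x, y)"] by (simp add: encode_Pair)
  moreover have "recursive 1 (\<lambda>xs. if f' (xs ! 0) = 0 then g' (xs ! 0)
      else h' (prod_encode (xs ! 0, f' (xs ! 0) - 1)))"
    by (intro recursive_if_zero f'(1) g'(1) h'(1) recursive_prod_encode recursive_pred recursive_nth)
      simp_all
  ultimately show ?thesis
    by (intro computableI[of "\<lambda>n. if f' n = 0 then g' n else h' (prod_encode (n, f' n - 1))"])
      (simp_all add: f'(2) g'(2) encode_option_def split: option.split)
qed

lemma computable_uncons:
  assumes "computable l"
  shows "computable (\<lambda>x. case l x of [] \<Rightarrow> None | y # ys \<Rightarrow> Some (y, ys))"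
  by (rule computable_compose[OF _ assms], rule computableI[of "\<lambda>n. n"])
    (simp_all add: recursive_nth encode_option_def encode_Nil encode_Cons encode_Pair split: list.split)

lemma computable_case_list [computable_intros]:
  assumes "computable l" "computable g" "computable (\<lambda>p. h (fst p) (fst (snd p)) (snd (snd p)))"
  shows "computable (\<lambda>x. case l x of [] \<Rightarrow> g x | y # ys \<Rightarrow> h x y ys)"
proof -
  have "computable (\<lambda>x. case (case l x of [] \<Rightarrow> None | y # ys \<Rightarrow> Some (y, ys)) of
      None \<Rightarrow> g x | Some p \<Rightarrow> h x (fst p) (snd p))"
    by (intro computable_intros computable_uncons assms)
  moreover have "(case (case l x of [] \<Rightarrow> None | y # ys \<Rightarrow> Some (y, ys)) of
      None \<Rightarrow> g x | Some p \<Rightarrow> h x (fst p) (snd p)) = (case l x of [] \<Rightarrow> g x | y # ys \<Rightarrow> h x y ys)" for x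
    by (simp split: list.split)
  ultimately show ?thesis by (simp only:)
qed

lemma computable_funpow [computable_intros]:
  fixes f :: "'a::encodable \<Rightarrow> 'b::encodable \<Rightarrow> 'b"
  assumes n: "computable n" and f: "computable (\<lambda>p. f (fst p) (snd p))" and s: "computable s"
  shows "computable (\<lambda>x. (f x ^^ n x) (s x))"
proof -
  obtain n' where n': "\<And>k h. recursive k h \<Longrightarrow> recursive k (\<lambda>xs. n' (h xs))"
    "\<And>x. n' (encode x) = n x"
    using n by (rule computableE) (auto simp: encode_nat_def)
  obtain f' where f': "\<And>k h. recursive k h \<Longrightarrow> recursive k (\<lambda>xs. f' (h xs))"
    "\<And>p. f' (encode p) = encode (f (fst p) (snd p))"
    using f by (rule computableE) blast
  obtain s' where s': "\<And>k h. recursive k h \<Longrightarrow> recursive k (\<lambda>xs. s' (h xs))"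
    "\<And>x. s' (encode x) = encode (s x)"
    using s by (rule computableE) blast
  have "f' (prod_encode (encode x, encode y)) = encode (f x y)" for x y
    using f'(2)[of "(x, y)"] by (simp add: encode_Pair)
  then have "rec_nat (encode (s x)) (\<lambda>i y. f' (prod_encode (encode x, y))) m
      = encode ((f x ^^ m) (s x))" for m x
    by (induction m) simp_all
  moreover have "recursive 1 (\<lambda>xs. rec_nat (s' (xs ! 0))
      (\<lambda>i y. f' (prod_encode (xs ! 0, y))) (n' (xs ! 0)))"
    by (intro recursive_rec_nat n'(1) s'(1) f'(1) recursive_prod_encode recursive_drop recursive_nth)
      simp_all
  ultimately show ?thesis
    by (intro computableI[of "\<lambda>m. rec_nat (s' m) (\<lambda>i y. f' (prod_encode (m, y))) (n' m)"])
      (simp_all add: n'(2) s'(2))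
qed

lemma computable_fold [computable_intros]:
  assumes l: "computable l" and f: "computable (\<lambda>p. f (fst p) (fst (snd p)) (snd (snd p)))"
    and s: "computable s"
  shows "computable (\<lambda>x. fold (f x) (l x) (s x))"
proof -
  define step where "step x q = (case fst q of [] \<Rightarrow> q | y # ys \<Rightarrow> (ys, f x y (snd q)))" for x q
  have "(step x ^^ n) (ys, a) = (drop n ys, fold (f x) (take n ys) a)" for x n ys a
  proof (induction n arbitrary: ys a)
    case (Suc n)
    then show ?case by (cases ys) (simp_all add: step_def funpow_Suc_right del: funpow.simps)
  qed simp
  then have "snd ((step x ^^ encode (l x)) (l x, s x)) = fold (f x) (l x) (s x)" for x
    using length_le_encode[of "l x"] by simp
  moreover have "computable (\<lambda>x. snd ((step x ^^ encode (l x)) (l x, s x)))"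
    unfolding step_def
    by (intro computable_intros computable_compose3[OF f] l s)
  ultimately show ?thesis by (simp only:)
qed

lemma computable_rev [computable_intros]: "computable l \<Longrightarrow> computable (\<lambda>x. rev (l x))"
  unfolding rev_conv_fold
  by (intro computable_intros)

lemma computable_foldr [computable_intros]:
  assumes "computable l" "computable (\<lambda>p. f (fst p) (fst (snd p)) (snd (snd p)))" "computable s"
  shows "computable (\<lambda>x. foldr (f x) (l x) (s x))"
  unfolding foldr_conv_fold by (intro computable_intros assms)

lemma computable_append [computable_intros]:
  assumes "computable f" "computable g"
  shows "computable (\<lambda>x. f x @ g x)"
proof -
  have "computable (\<lambda>x. foldr (#) (f x) (g x))"
    by (intro computable_intros assms)
  moreover have "foldr (#) xs ys = xs @ ys" for xs ys :: "'b list" by (induction xs) simp_all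
  ultimately show ?thesis by simp
qed

lemma computable_concat_map [computable_intros]:
  assumes "computable l" "computable (\<lambda>p. f (fst p) (snd p))"
  shows "computable (\<lambda>x. concat (map (f x) (l x)))"
proof -
  have "computable (\<lambda>x. foldr (\<lambda>y ys. f x y @ ys) (l x) [])"
    by (intro computable_intros computable_compose2[OF assms(2)] assms(1))
  moreover have "foldr (\<lambda>y ys. f x y @ ys) xs [] = concat (map (f x) xs)" for x xs
    by (induction xs) simp_all
  ultimately show ?thesis by simp
qed

lemma computable_map [computable_intros]:
  assumes "computable l" "computable (\<lambda>p. f (fst p) (snd p))"
  shows "computable (\<lambda>x. map (f x) (l x))"
proof -
  have "computable (\<lambda>x. concat (map (\<lambda>y. [f x y]) (l x)))"
    by (intro computable_intros assms)
  moreover have "concat (map (\<lambda>y. [f x y]) xs) = map (f x) xs" for x xs by (induction xs) simp_all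
  ultimately show ?thesis by simp
qed

lemma computable_filter [computable_intros]:
  assumes "computable l" "computable (\<lambda>p. P (fst p) (snd p))"
  shows "computable (\<lambda>x. filter (P x) (l x))"
proof -
  have "computable (\<lambda>x. concat (map (\<lambda>y. if P x y then [y] else []) (l x)))"
    by (intro computable_intros assms)
  moreover have "concat (map (\<lambda>y. if P x y then [y] else []) xs) = filter (P x) xs" for x xs
    by (induction xs) simp_all
  ultimately show ?thesis by simp
qed

lemma computable_length [computable_intros]:
  assumes "computable l"
  shows "computable (\<lambda>x. length (l x))"
proof -
  have "computable (\<lambda>x. foldr (\<lambda>y n. Suc n) (l x) 0)"
    by (intro computable_intros assms)
  moreover have "foldr (\<lambda>y n. Suc n) xs 0 = length xs" for xs :: "'b list" by (induction xs) simp_all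
  ultimately show ?thesis by simp
qed

lemma computable_subseqs [computable_intros]:
  assumes "computable l"
  shows "computable (\<lambda>x. subseqs (l x))"
proof -
  have "computable (\<lambda>x. foldr (\<lambda>y yss. map ((#) y) yss @ yss) (l x) [[]])"
    by (intro computable_intros assms)
  moreover have "foldr (\<lambda>y yss. map ((#) y) yss @ yss) xs [[]] = subseqs xs" for xs :: "'b list"
    by (induction xs) (simp_all add: Let_def)
  ultimately show ?thesis by simp
qed

lemma computable_find [computable_intros]:
  assumes "computable l" "computable (\<lambda>p. P (fst p) (snd p))"
  shows "computable (\<lambda>x. find (P x) (l x))"
proof -
  have "computable (\<lambda>x. foldr (\<lambda>y r. if P x y then Some y else r) (l x) None)"
    by (intro computable_intros computable_compose2[OF assms(2)] assms(1))
  moreover have "foldr (\<lambda>y r. if P x y then Some y else r) xs None = find (P x) xs" for x xs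
    by (induction xs) simp_all
  ultimately show ?thesis by simp
qed

lemma computable_bex [computable_intros]:
  assumes "computable l" "computable (\<lambda>p. P (fst p) (snd p))"
  shows "computable (\<lambda>x. \<exists>y\<in>set (l x). P x y)"
proof -
  have "computable (\<lambda>x. filter (P x) (l x) \<noteq> [])"
    by (intro computable_intros assms)
  then show ?thesis by (simp add: filter_empty_conv)
qed

lemma computable_ball [computable_intros]:
  assumes "computable l" "computable (\<lambda>p. P (fst p) (snd p))"
  shows "computable (\<lambda>x. \<forall>y\<in>set (l x). P x y)"
proof -
  have "computable (\<lambda>x. filter (\<lambda>y. \<not> P x y) (l x) = [])"
    by (intro computable_intros assms)
  then show ?thesis by (simp add: filter_empty_conv)
qed

lemma computable_member [computable_intros]:
  assumes "computable f" "computable l"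
  shows "computable (\<lambda>x. f x \<in> set (l x))"
proof -
  have "computable (\<lambda>x. \<exists>y\<in>set (l x). f x = y)"
    by (intro computable_intros computable_compose[OF assms(1)] assms(2))
  then show ?thesis by simp
qed

lemma computable_map_of [computable_intros]:
  assumes "computable l" "computable k"
  shows "computable (\<lambda>x. map_of (l x) (k x))"
proof -
  have "computable (\<lambda>x. case find (\<lambda>p. fst p = k x) (l x) of None \<Rightarrow> None | Some p \<Rightarrow> Some (snd p))"
    by (intro computable_intros computable_compose[OF assms(2)] assms(1))
  moreover have "(case find (\<lambda>p. fst p = k) ps of None \<Rightarrow> None | Some p \<Rightarrow> Some (snd p)) = map_of ps k"
    for ps :: "('b \<times> 'c) list" and k
    by (induction ps) auto
  ultimately show ?thesis by simp
qed

section \<open>Saturation of finite sets\<close>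

definition add_successors :: "('a \<Rightarrow> 'a list) \<Rightarrow> 'a list \<Rightarrow> 'a list" where
  "add_successors succs L = L @ concat (map succs L)"

definition saturate :: "'a list \<Rightarrow> ('a \<Rightarrow> 'a list) \<Rightarrow> 'a list \<Rightarrow> 'a list" where
  "saturate U succs I = (add_successors succs ^^ length U) I"

lemma set_add_successors: "set (add_successors succs L) = set L \<union> (\<Union>u\<in>set L. set (succs u))"
  by (simp add: add_successors_def)

lemma increasing_iteration_stabilises:
  fixes L :: "nat \<Rightarrow> 'a set"
  assumes bounded: "\<And>n. L n \<subseteq> U" "finite U"
    and iteration: "\<And>n. L (Suc n) = F (L n)"
    and increasing: "\<And>n. L n \<subseteq> L (Suc n)"
    and "card U \<le> n"
  shows "L (Suc n) = L n"
proof -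
  have "mono L" using increasing by (rule mono_iff_le_Suc[THEN iffD2, rule_format])
  moreover have "range L \<subseteq> Pow U" using bounded(1) by blast
  then have "finite (range L)" by (rule finite_subset) (simp add: bounded(2))
  moreover have "\<forall>n. L n = L (Suc n) \<longrightarrow> L (Suc n) = L (Suc (Suc n))"
    unfolding iteration by (intro allI impI, drule arg_cong[where f = F])
  ultimately have "\<exists>N. (\<forall>n\<le>N. \<forall>m\<le>N. m < n \<longrightarrow> L m \<subset> L n) \<and> (\<forall>n\<ge>N. L N = L n)"
    by (intro finite_mono_remains_stable_implies_strict_prefix)
  then have "L (card U) = (\<Union>n. L n)"
    by (intro finite_mono_strict_prefix_implies_finite_fixpoint bounded)
  then have "L (Suc n) \<subseteq> L (card U)" by (simp add: UN_upper)
  also have "\<dots> \<subseteq> L n" using \<open>mono L\<close> \<open>card U \<le> n\<close> by (rule monoD)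
  finally show ?thesis using increasing[of n] by (rule subset_antisym)
qed

lemma saturate_closed:
  assumes I: "set I \<subseteq> set U" and succs: "\<And>u. u \<in> set U \<Longrightarrow> set (succs u) \<subseteq> set U"
    and u: "u \<in> set (saturate U succs I)" and v: "v \<in> set (succs u)"
  shows "v \<in> set (saturate U succs I)"
proof -
  define L where "L n = set ((add_successors succs ^^ n) I)" for n
  have L_Suc: "L (Suc n) = L n \<union> (\<Union>u\<in>L n. set (succs u))" for n
    by (simp add: L_def set_add_successors)
  have "L n \<subseteq> set U" for n
  proof (induction n)
    case 0
    show ?case using I by (simp add: L_def)
  next
    case (Suc n)
    then show ?case using succs unfolding L_Suc by blast
  qed
  then have "L (Suc (length U)) = L (length U)"
    by (rule increasing_iteration_stabilises[where L = L and F = "\<lambda>A. A \<union> (\<Union>u\<in>A. set (succs u))"])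
      (simp_all add: L_Suc card_length)
  then show ?thesis using u v L_Suc[of "length U"] unfolding saturate_def L_def by blast
qed

lemma iterated_successors_reachable:
  assumes "v \<in> set ((add_successors succs ^^ n) I)"
  shows "\<exists>u\<in>set I. (\<lambda>u v. v \<in> set (succs u))\<^sup>*\<^sup>* u v"
  using assms
proof (induction n arbitrary: v)
  case 0
  then show ?case by auto
next
  case (Suc n)
  then consider (old) "v \<in> set ((add_successors succs ^^ n) I)"
    | (new) u where "u \<in> set ((add_successors succs ^^ n) I)" "v \<in> set (succs u)"
    by (auto simp: set_add_successors)
  then show ?case
  proof cases
    case old
    then show ?thesis by (rule Suc.IH)
  next
    case new
    from Suc.IH[OF new(1)] new(2) show ?thesis by (meson rtranclp.rtrancl_into_rtrancl)
  qed
qed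

lemma set_saturate:
  assumes I: "set I \<subseteq> set U" and succs: "\<And>u. u \<in> set U \<Longrightarrow> set (succs u) \<subseteq> set U"
  shows "set (saturate U succs I) = {v. \<exists>u\<in>set I. (\<lambda>u v. v \<in> set (succs u))\<^sup>*\<^sup>* u v}"
proof (intro set_eqI iffI CollectI)
  fix v
  assume "v \<in> set (saturate U succs I)"
  then show "\<exists>u\<in>set I. (\<lambda>u v. v \<in> set (succs u))\<^sup>*\<^sup>* u v"
    unfolding saturate_def by (rule iterated_successors_reachable)
next
  fix v
  assume "v \<in> {v. \<exists>u\<in>set I. (\<lambda>u v. v \<in> set (succs u))\<^sup>*\<^sup>* u v}"
  then obtain u where u: "u \<in> set I" and "(\<lambda>u v. v \<in> set (succs u))\<^sup>*\<^sup>* u v" by blast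
  from this(2) show "v \<in> set (saturate U succs I)"
  proof (induction rule: rtranclp_induct)
    case base
    have "set I \<subseteq> set ((add_successors succs ^^ n) I)" for n
      by (induction n) (auto simp: set_add_successors)
    then show ?case using u unfolding saturate_def by blast
  next
    case (step v w)
    show ?case by (rule saturate_closed[OF I succs step.IH step.hyps(2)])
  qed
qed

section \<open>Transition monoids of finite automata\<close>

abbreviation nfa_init :: "'a nfa \<Rightarrow> nat" where "nfa_init A \<equiv> fst A"
abbreviation nfa_finals :: "'a nfa \<Rightarrow> nat list" where "nfa_finals A \<equiv> fst (snd A)"
abbreviation nfa_trans :: "'a nfa \<Rightarrow> (nat \<times> 'a \<times> nat) list" where "nfa_trans A \<equiv> snd (snd A)"

abbreviation nfa_run :: "'a nfa \<Rightarrow> 'a list \<Rightarrow> nat \<Rightarrow> bool" where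
  "nfa_run A \<equiv> nfa_path (nfa_trans A) (nfa_init A)"

definition nfa_states :: "'a nfa \<Rightarrow> nat list" where
  "nfa_states A = nfa_init A # map (\<lambda>t. snd (snd t)) (nfa_trans A)"

lemma nfa_lang_iff: "x \<in> nfa_lang A \<longleftrightarrow> (\<exists>f\<in>set (nfa_finals A). nfa_run A x f)"
  by (cases A) (simp add: nfa_lang_def)

lemma nfa_path_Nil_iff [simp]: "nfa_path \<delta> p [] q \<longleftrightarrow> p = q"
  by (auto intro: nfa_path.nil elim: nfa_path.cases)

lemma nfa_path_Cons_iff [simp]:
  "nfa_path \<delta> p (a # x) q \<longleftrightarrow> (\<exists>r. (p, a, r) \<in> set \<delta> \<and> nfa_path \<delta> r x q)"
  by (auto intro: nfa_path.cons elim: nfa_path.cases)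

lemma nfa_path_append: "nfa_path \<delta> p (x @ y) q \<longleftrightarrow> (\<exists>r. nfa_path \<delta> p x r \<and> nfa_path \<delta> r y q)"
  by (induction x arbitrary: p) auto

lemma nfa_init_in_states: "nfa_init A \<in> set (nfa_states A)"
  by (simp add: nfa_states_def)

lemma nfa_trans_in_states: "(p, a, q) \<in> set (nfa_trans A) \<Longrightarrow> q \<in> set (nfa_states A)"
  by (force simp: nfa_states_def)

lemma nfa_path_in_states:
  assumes "nfa_path (nfa_trans A) p x q" "p \<in> set (nfa_states A)"
  shows "q \<in> set (nfa_states A)"
  using assms by (induction x arbitrary: p) (auto intro: nfa_trans_in_states)

text \<open>The transition relation of a word in all automata of a list at once is represented by the
  sublist of this list of triples, so that equal relations have equal representations.\<close>

definition state_pairs :: "'a nfa list \<Rightarrow> ('a nfa \<times> nat \<times> nat) list" where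
  "state_pairs As = concat (map (\<lambda>A.
     concat (map (\<lambda>p. map (\<lambda>q. (A, p, q)) (nfa_states A)) (nfa_states A))) As)"

definition empty_word_relation :: "'a nfa list \<Rightarrow> ('a nfa \<times> nat \<times> nat) list" where
  "empty_word_relation As = filter (\<lambda>(A, p, q). p = q) (state_pairs As)"

definition append_letter ::
  "'a nfa list \<Rightarrow> ('a nfa \<times> nat \<times> nat) list \<Rightarrow> 'a \<Rightarrow> ('a nfa \<times> nat \<times> nat) list" where
  "append_letter As t b = filter (\<lambda>(A, p, q). \<exists>(A', p', r)\<in>set t.
     A' = A \<and> p' = p \<and> (r, b, q) \<in> set (nfa_trans A)) (state_pairs As)"

definition word_relation :: "'a nfa list \<Rightarrow> 'a list \<Rightarrow> ('a nfa \<times> nat \<times> nat) list" where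
  "word_relation As x = foldl (append_letter As) (empty_word_relation As) x"

definition transition_monoid :: "'a nfa list \<Rightarrow> 'a list \<Rightarrow> ('a nfa \<times> nat \<times> nat) list list" where
  "transition_monoid As M =
     saturate (subseqs (state_pairs As)) (\<lambda>t. map (append_letter As t) M) [empty_word_relation As]"

lemma set_state_pairs:
  "set (state_pairs As) = {(A, p, q). A \<in> set As \<and> p \<in> set (nfa_states A) \<and> q \<in> set (nfa_states A)}"
  by (auto simp: state_pairs_def)

lemma word_relation_Nil: "word_relation As [] = empty_word_relation As"
  by (simp add: word_relation_def)

lemma word_relation_snoc: "word_relation As (x @ [b]) = append_letter As (word_relation As x) b"
  by (simp add: word_relation_def)

lemma word_relation_iff:
  assumes "A \<in> set As" "p \<in> set (nfa_states A)"
  shows "(A, p, q) \<in> set (word_relation As x) \<longleftrightarrow> nfa_path (nfa_trans A) p x q"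
proof (induction x arbitrary: q rule: rev_induct)
  case Nil
  show ?case using assms by (auto simp: word_relation_Nil empty_word_relation_def set_state_pairs)
next
  case (snoc b x)
  then show ?case using assms
    by (auto simp: word_relation_snoc append_letter_def set_state_pairs nfa_path_append
        intro: nfa_trans_in_states)
qed

lemma set_transition_monoid:
  "set (transition_monoid As M) = word_relation As ` lists (set M)" (is "?L = ?R")
proof -
  let ?succ = "\<lambda>t t'. t' \<in> set (map (append_letter As t) M)"
  have L: "?L = {t. ?succ\<^sup>*\<^sup>* (empty_word_relation As) t}"
    unfolding transition_monoid_def
    by (subst set_saturate) (auto simp: empty_word_relation_def append_letter_def)
  have "t \<in> ?R" if "?succ\<^sup>*\<^sup>* (empty_word_relation As) t" for t
    using that
  proof (induction rule: rtranclp_induct)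
    case base
    show ?case by (rule image_eqI[of _ _ "[]"]) (simp_all add: word_relation_Nil)
  next
    case (step t t')
    then obtain x b where "x \<in> lists (set M)" "b \<in> set M" "t' = word_relation As (x @ [b])"
      by (auto simp: word_relation_snoc)
    then show ?case by (intro image_eqI[of _ _ "x @ [b]"]) simp_all
  qed
  moreover have "?succ\<^sup>*\<^sup>* (empty_word_relation As) (word_relation As x)" if "x \<in> lists (set M)" for x
    using that
  proof (induction x rule: rev_induct)
    case Nil
    show ?case by (simp add: word_relation_Nil)
  next
    case (snoc b x)
    then show ?case by (auto simp: word_relation_snoc intro: rtranclp.rtrancl_into_rtrancl)
  qed
  ultimately show ?thesis unfolding L by blast
qed

definition accepts_from :: "('a nfa \<times> nat \<times> nat) list \<Rightarrow> 'a nfa \<Rightarrow> nat \<Rightarrow> bool" where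
  "accepts_from t A q \<longleftrightarrow> (\<exists>f\<in>set (nfa_finals A). (A, q, f) \<in> set t)"

lemma accepts_from_word_relation:
  assumes "A \<in> set As" "q \<in> set (nfa_states A)"
  shows "accepts_from (word_relation As x) A q \<longleftrightarrow> (\<exists>f\<in>set (nfa_finals A). nfa_path (nfa_trans A) q x f)"
  by (simp add: accepts_from_def word_relation_iff assms)

definition monoid_nfa ::
  "'a::encodable nfa list \<Rightarrow> 'a list \<Rightarrow> (('a nfa \<times> nat \<times> nat) list \<Rightarrow> bool) \<Rightarrow> 'a nfa" where
  "monoid_nfa As M acc = (let Ts = transition_monoid As M in
     (encode (empty_word_relation As), map encode (filter acc Ts),
      concat (map (\<lambda>t. map (\<lambda>b. (encode t, b, encode (append_letter As t b))) M) Ts)))"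

lemma nfa_trans_monoid_nfa:
  "set (nfa_trans (monoid_nfa As M acc)) =
     {(encode (word_relation As x), b, encode (word_relation As (x @ [b]))) | x b.
        x \<in> lists (set M) \<and> b \<in> set M}"
  by (auto simp: monoid_nfa_def Let_def set_transition_monoid word_relation_snoc image_iff)

lemma nfa_path_monoid_nfa:
  "nfa_run (monoid_nfa As M acc) x q
     \<longleftrightarrow> x \<in> lists (set M) \<and> q = encode (word_relation As x)"
proof (induction x arbitrary: q rule: rev_induct)
  case Nil
  show ?case by (auto simp: monoid_nfa_def Let_def word_relation_Nil)
next
  case (snoc b x)
  then show ?case
    by (auto simp: nfa_path_append nfa_trans_monoid_nfa encode_eq_iff word_relation_snoc)
qed

lemma nfa_lang_monoid_nfa:
  "nfa_lang (monoid_nfa As M acc) = {x \<in> lists (set M). acc (word_relation As x)}"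
proof -
  have "set (nfa_finals (monoid_nfa As M acc)) =
      {encode (word_relation As x) | x. x \<in> lists (set M) \<and> acc (word_relation As x)}"
    by (auto simp: monoid_nfa_def Let_def set_transition_monoid)
  then show ?thesis by (auto simp: nfa_lang_iff nfa_path_monoid_nfa encode_eq_iff)
qed

section \<open>Rendezvous computations of cyclic protocols\<close>

abbreviation can_send ::
  "('n, 'e, 'm, 's) protocol \<Rightarrow> ('n \<Rightarrow> 's) \<Rightarrow> 'e \<Rightarrow> 'm \<Rightarrow> 's \<Rightarrow> bool" where
  "can_send P S \<xi> b q \<equiv> (S (ptail P \<xi>), Snd b, q) \<in> ptrans P (ptail P \<xi>)"

abbreviation can_recv ::
  "('n, 'e, 'm, 's) protocol \<Rightarrow> ('n \<Rightarrow> 's) \<Rightarrow> 'e \<Rightarrow> 'm \<Rightarrow> 's \<Rightarrow> bool" where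
  "can_recv P S \<xi> b q \<equiv> (S (phead P \<xi>), Rcv b, q) \<in> ptrans P (phead P \<xi>)"

inductive sync :: "('n, 'e, 'm, 's) protocol \<Rightarrow> 'e \<Rightarrow> ('n \<Rightarrow> 's) \<Rightarrow> 'm list \<Rightarrow> ('n \<Rightarrow> 's) \<Rightarrow> bool"
  for P \<beta> where
  idle: "sync P \<beta> S [] S"
| deliver: "\<lbrakk> sync P \<beta> S u S'; b \<in> pmsgs P \<beta>; can_recv P S' \<beta> b q \<rbrakk>
    \<Longrightarrow> sync P \<beta> S (u @ [b]) (S'(phead P \<beta> := q))"
| rendezvous: "\<lbrakk> sync P \<beta> S u S'; \<xi> \<in> pedges P; \<xi> \<noteq> \<beta>; b \<in> pmsgs P \<xi>;
      can_send P S' \<xi> b p; can_recv P S' \<xi> b q \<rbrakk>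
    \<Longrightarrow> sync P \<beta> S u (S'(ptail P \<xi> := p, phead P \<xi> := q))"

definition emits :: "('n, 'e, 'm, 's) protocol \<Rightarrow> 'e \<Rightarrow> ('n \<Rightarrow> 's) \<Rightarrow> 'm \<Rightarrow> ('n \<Rightarrow> 's) \<Rightarrow> bool" where
  "emits P \<beta> S b S' \<longleftrightarrow> b \<in> pmsgs P \<beta> \<and> (\<exists>q. can_send P S \<beta> b q \<and> S' = S(ptail P \<beta> := q))"

definition drain :: "('n, 'e, 'm, 's) protocol \<Rightarrow> 'e \<Rightarrow> ('n \<Rightarrow> 's set)
    \<Rightarrow> (('n \<Rightarrow> 's) \<Rightarrow> 'm list set) \<Rightarrow> ('n \<Rightarrow> 's) \<Rightarrow> 'm list set" where
  "drain P \<beta> V Q S = {x. \<exists>S\<^sub>0\<in>Pi\<^sub>E (pnodes P) V. \<exists>u. sync P \<beta> S\<^sub>0 u S \<and> u @ x \<in> Q S\<^sub>0}"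

definition emission_closed :: "('n, 'e, 'm, 's) protocol \<Rightarrow> 'e \<Rightarrow> ('n \<Rightarrow> 's set)
    \<Rightarrow> (('n \<Rightarrow> 's) \<Rightarrow> 'm list set) \<Rightarrow> bool" where
  "emission_closed P \<beta> V Q \<longleftrightarrow> (\<forall>S. \<forall>x\<in>drain P \<beta> V Q S. \<forall>b. \<forall>S'\<in>Pi\<^sub>E (pnodes P) V.
     emits P \<beta> S b S' \<longrightarrow> x @ [b] \<in> Q S')"

definition only_channel :: "'e \<Rightarrow> 'm list \<Rightarrow> 'e \<Rightarrow> 'm list" where
  "only_channel \<beta> x = (\<lambda>\<xi>. [])(\<beta> := x)"

lemma only_channel_simps [simp]: "only_channel \<beta> x \<beta> = x" "\<xi> \<noteq> \<beta> \<Longrightarrow> only_channel \<beta> x \<xi> = []"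
  by (simp_all add: only_channel_def)

lemma only_channel_upd [simp]: "(only_channel \<beta> x)(\<beta> := y) = only_channel \<beta> y"
  by (simp add: only_channel_def)

lemma eq_only_channel: "(\<And>\<xi>. \<xi> \<noteq> \<beta> \<Longrightarrow> C \<xi> = []) \<Longrightarrow> C = only_channel \<beta> (C \<beta>)"
  by (auto simp: only_channel_def)

lemma sync_trans: "sync P \<beta> S' v S'' \<Longrightarrow> sync P \<beta> S u S' \<Longrightarrow> sync P \<beta> S (u @ v) S''"
  by (induction rule: sync.induct)
    (auto simp flip: append_assoc intro: sync.deliver sync.rendezvous)

lemma deliver_sync:
  assumes "b \<in> pmsgs P \<beta>" "can_recv P S \<beta> b q"
    and "sync P \<beta> (S(phead P \<beta> := q)) u S'"
  shows "sync P \<beta> S (b # u) S'"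
  using sync_trans[OF assms(3), of S "[b]"] sync.deliver[OF sync.idle, of b P \<beta> S q] assms(1,2) by simp

lemma rendezvous_sync:
  assumes "\<xi> \<in> pedges P" "\<xi> \<noteq> \<beta>" "b \<in> pmsgs P \<xi>"
    and "can_send P S \<xi> b p" "can_recv P S \<xi> b q"
    and "sync P \<beta> (S(ptail P \<xi> := p, phead P \<xi> := q)) u S'"
  shows "sync P \<beta> S u S'"
  using sync_trans[OF assms(6) sync.rendezvous[OF sync.idle assms(1-5)]] by simp

lemma drainI: "S\<^sub>0 \<in> Pi\<^sub>E (pnodes P) V \<Longrightarrow> sync P \<beta> S\<^sub>0 u S \<Longrightarrow> u @ x \<in> Q S\<^sub>0 \<Longrightarrow> x \<in> drain P \<beta> V Q S"
  unfolding drain_def by blast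

lemma drainE:
  assumes "x \<in> drain P \<beta> V Q S"
  obtains S\<^sub>0 u where "S\<^sub>0 \<in> Pi\<^sub>E (pnodes P) V" "sync P \<beta> S\<^sub>0 u S" "u @ x \<in> Q S\<^sub>0"
  using assms unfolding drain_def by blast

lemma subset_drain: "S \<in> Pi\<^sub>E (pnodes P) V \<Longrightarrow> Q S \<subseteq> drain P \<beta> V Q S"
  by (auto intro: drainI sync.idle)

lemma drain_subset_lists:
  assumes "\<And>S. S \<in> Pi\<^sub>E (pnodes P) V \<Longrightarrow> Q S \<subseteq> lists A"
  shows "drain P \<beta> V Q S \<subseteq> lists A"
  using assms by (fastforce elim: drainE)

lemma consistentD:
  assumes "consistent P \<beta> Q" "S \<in> comp_states P" "x \<in> Q S"
    and "(step P)\<^sup>*\<^sup>* (S, only_channel \<beta> x) (S', only_channel \<beta> x')"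
  shows "x' \<in> Q S'"
  using assms(1)[unfolded consistent_def, rule_format, of S "only_channel \<beta> x" S' "only_channel \<beta> x'"]
    assms(2-4) by simp

subsection \<open>Local runs\<close>

fun local_run :: "('s \<times> 'm act \<times> 's) set \<Rightarrow> 's \<Rightarrow> 'm act list \<Rightarrow> 's \<Rightarrow> bool" where
  "local_run T p [] q \<longleftrightarrow> p = q"
| "local_run T p (a # w) q \<longleftrightarrow> (\<exists>r. (p, a, r) \<in> T \<and> local_run T r w q)"

fun sends :: "'m act list \<Rightarrow> 'm list" where
  "sends [] = []"
| "sends (Snd b # w) = b # sends w"
| "sends (Rcv b # w) = sends w"

fun recvs :: "'m act list \<Rightarrow> 'm list" where
  "recvs [] = []"
| "recvs (Snd b # w) = recvs w"
| "recvs (Rcv b # w) = b # recvs w"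

lemma local_run_append:
  "local_run T p (u @ v) q \<longleftrightarrow> (\<exists>r. local_run T p u r \<and> local_run T r v q)"
  by (induction u arbitrary: p) auto

lemma sends_append [simp]: "sends (u @ v) = sends u @ sends v"
  by (induction u rule: sends.induct) auto

lemma recvs_append [simp]: "recvs (u @ v) = recvs u @ recvs v"
  by (induction u rule: recvs.induct) auto

lemma starts_with_SndI: "sends w \<noteq> [] \<Longrightarrow> \<nexists>b v. w = Rcv b # v \<Longrightarrow> \<exists>b v. w = Snd b # v"
  by (cases w rule: sends.cases) auto

lemma starts_with_RcvI: "w \<noteq> [] \<Longrightarrow> sends w = [] \<Longrightarrow> \<exists>b v. w = Rcv b # v"
  by (cases w rule: sends.cases) auto

lemma local_run_closed:
  assumes "local_run T p w q" "p \<in> K" "T \<subseteq> K \<times> A \<times> K"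
  shows "q \<in> K"
  using assms by (induction w arbitrary: p) auto

locale cyclic_protocol =
  fixes P :: "('n, 'e, 'm, 's) protocol" and \<beta> :: 'e and V :: "'n \<Rightarrow> 's set"
  assumes wf: "wf_protocol P" and cyclic: "cyclic P" and \<beta>: "\<beta> \<in> pedges P" and good_V: "good_V P V"
begin

lemma finite_nodes: "finite (pnodes P)"
  using wf unfolding wf_protocol_def by blast

lemma tail_node: "\<xi> \<in> pedges P \<Longrightarrow> ptail P \<xi> \<in> pnodes P"
  and head_node: "\<xi> \<in> pedges P \<Longrightarrow> phead P \<xi> \<in> pnodes P"
  using wf unfolding wf_protocol_def by blast+

lemma tail_eq_iff: "\<xi> \<in> pedges P \<Longrightarrow> \<eta> \<in> pedges P \<Longrightarrow> ptail P \<xi> = ptail P \<eta> \<longleftrightarrow> \<xi> = \<eta>"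
  and head_eq_iff: "\<xi> \<in> pedges P \<Longrightarrow> \<eta> \<in> pedges P \<Longrightarrow> phead P \<xi> = phead P \<eta> \<longleftrightarrow> \<xi> = \<eta>"
  using cyclic unfolding cyclic_def bij_betw_def inj_on_def by blast+

lemma out_edge:
  assumes "j \<in> pnodes P"
  obtains \<xi> where "\<xi> \<in> pedges P" "ptail P \<xi> = j"
proof -
  have "j \<in> ptail P ` pedges P" using cyclic assms unfolding cyclic_def bij_betw_def by simp
  then show thesis using that by blast
qed

lemma in_edge:
  assumes "j \<in> pnodes P"
  obtains \<xi> where "\<xi> \<in> pedges P" "phead P \<xi> = j"
proof -
  have "j \<in> phead P ` pedges P" using cyclic assms unfolding cyclic_def bij_betw_def by simp
  then show thesis using that by blast
qed

lemma trans_subset: "j \<in> pnodes P \<Longrightarrow> ptrans P j \<subseteq> pstates P j \<times> alphabet P j \<times> pstates P j"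
  using wf unfolding wf_protocol_def by blast

lemma send_msg:
  assumes "\<xi> \<in> pedges P" "(p, Snd b, q) \<in> ptrans P (ptail P \<xi>)"
  shows "b \<in> pmsgs P \<xi>"
proof -
  have "Snd b \<in> alphabet P (ptail P \<xi>)" using assms trans_subset[OF tail_node] by blast
  then show ?thesis using tail_eq_iff assms(1) unfolding alphabet_def by auto
qed

lemma recv_msg:
  assumes "\<xi> \<in> pedges P" "(p, Rcv b, q) \<in> ptrans P (phead P \<xi>)"
  shows "b \<in> pmsgs P \<xi>"
proof -
  have "Rcv b \<in> alphabet P (phead P \<xi>)" using assms trans_subset[OF head_node] by blast
  then show ?thesis using head_eq_iff assms(1) unfolding alphabet_def by auto
qed

lemma send_in_V: "j \<in> pnodes P \<Longrightarrow> (p, Snd b, q) \<in> ptrans P j \<Longrightarrow> q \<in> V j"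
  using good_V unfolding good_V_def by blast

lemma PiE_V_subset: "Pi\<^sub>E (pnodes P) V \<subseteq> comp_states P"
  unfolding comp_states_def by (rule PiE_mono) (use good_V in \<open>auto simp: good_V_def\<close>)

lemma comp_states_upd:
  assumes "S \<in> comp_states P" "j \<in> pnodes P" "(p, a, q) \<in> ptrans P j"
  shows "S(j := q) \<in> comp_states P"
  using assms trans_subset[of j] unfolding comp_states_def
  by (auto simp: PiE_def Pi_def extensional_def)

lemma step_comp_states: "step P s s' \<Longrightarrow> fst s \<in> comp_states P \<Longrightarrow> fst s' \<in> comp_states P"
  by (induction rule: step.induct) (auto intro: comp_states_upd tail_node head_node)

lemma sync_comp_states: "sync P \<beta> S u S' \<Longrightarrow> S \<in> comp_states P \<Longrightarrow> S' \<in> comp_states P"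
  by (induction rule: sync.induct) (auto intro: comp_states_upd tail_node head_node \<beta>)

definition depth :: "'n \<Rightarrow> nat" where
  "depth j = (LEAST n. (phead P \<beta>, j) \<in> {(ptail P \<xi>, phead P \<xi>) | \<xi>. \<xi> \<in> pedges P} ^^ n)"

lemma depth_head:
  assumes \<xi>: "\<xi> \<in> pedges P" "\<xi> \<noteq> \<beta>"
  shows "depth (phead P \<xi>) = Suc (depth (ptail P \<xi>))"
proof (rule antisym)
  let ?E = "{(ptail P \<xi>, phead P \<xi>) | \<xi>. \<xi> \<in> pedges P}"
  have path: "(phead P \<beta>, j) \<in> ?E ^^ depth j" if "j \<in> pnodes P" for j
  proof -
    have "(phead P \<beta>, j) \<in> ?E\<^sup>*" using cyclic that head_node[OF \<beta>] unfolding cyclic_def by simp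
    then show ?thesis unfolding depth_def rtrancl_power by (rule LeastI_ex)
  qed
  have least: "depth j \<le> n" if "(phead P \<beta>, j) \<in> ?E ^^ n" for j n
    unfolding depth_def using that by (rule Least_le)
  show "depth (phead P \<xi>) \<le> Suc (depth (ptail P \<xi>))"
    using path[OF tail_node[OF \<xi>(1)]] \<xi>(1) by (intro least relpow_Suc_I) auto
  have "phead P \<beta> \<noteq> phead P \<xi>" using \<xi> \<beta> head_eq_iff by simp
  with path[OF head_node[OF \<xi>(1)]] obtain n k where "depth (phead P \<xi>) = Suc n"
    and k: "(phead P \<beta>, k) \<in> ?E ^^ n" "(k, phead P \<xi>) \<in> ?E"
    by (cases "depth (phead P \<xi>)") auto
  moreover from k(2) have "k = ptail P \<xi>" using head_eq_iff \<xi>(1) by auto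
  ultimately show "Suc (depth (ptail P \<xi>)) \<le> depth (phead P \<xi>)" using least by simp
qed

lemma tail_neq_head: "\<xi> \<in> pedges P \<Longrightarrow> \<xi> \<noteq> \<beta> \<Longrightarrow> ptail P \<xi> \<noteq> phead P \<xi>"
  using depth_head by (metis n_not_Suc_n)

subsection \<open>Rendezvous computations are computations\<close>

lemma rendezvous_steps:
  assumes "\<xi> \<in> pedges P" "\<xi> \<noteq> \<beta>" "b \<in> pmsgs P \<xi>"
    and "can_send P S \<xi> b p" "can_recv P S \<xi> b q"
  shows "(step P)\<^sup>*\<^sup>* (S, only_channel \<beta> x) (S(ptail P \<xi> := p, phead P \<xi> := q), only_channel \<beta> x)"
proof -
  let ?C = "(only_channel \<beta> x)(\<xi> := [b])"
  have "step P (S, only_channel \<beta> x) (S(ptail P \<xi> := p), ?C)"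
    using step.send[of \<xi> P "ptail P \<xi>" b S p "only_channel \<beta> x"] assms by simp
  moreover have "step P (S(ptail P \<xi> := p), ?C) (S(ptail P \<xi> := p, phead P \<xi> := q), ?C(\<xi> := []))"
    using assms tail_neq_head[of \<xi>] by (intro step.recv[where b = b]) auto
  moreover have "?C(\<xi> := []) = only_channel \<beta> x" using assms(2) by (auto simp: only_channel_def)
  ultimately show ?thesis by simp
qed

lemma sync_steps:
  assumes "sync P \<beta> S u S'"
  shows "(step P)\<^sup>*\<^sup>* (S, only_channel \<beta> (u @ x)) (S', only_channel \<beta> x)"
  using assms
proof (induction arbitrary: x)
  case (idle S)
  show ?case by simp
next
  case (deliver S u S' b q)
  have "step P (S', only_channel \<beta> (b # x)) (S'(phead P \<beta> := q), only_channel \<beta> x)"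
    using step.recv[OF \<beta> refl deliver.hyps(2), of S' q "only_channel \<beta> (b # x)" x] deliver.hyps(3)
    by simp
  with deliver.IH[of "b # x"] show ?case unfolding append_assoc append_Cons append_Nil
    by (rule rtranclp.rtrancl_into_rtrancl)
next
  case (rendezvous S u S' \<xi> b p q)
  from rendezvous.IH rendezvous_steps[OF rendezvous.hyps(2-6)] show ?case by (rule rtranclp_trans)
qed

lemma emits_step:
  assumes "emits P \<beta> S b S'"
  shows "step P (S, only_channel \<beta> x) (S', only_channel \<beta> (x @ [b]))"
proof -
  obtain q where "b \<in> pmsgs P \<beta>" "can_send P S \<beta> b q" "S' = S(ptail P \<beta> := q)"
    using assms unfolding emits_def by blast
  with step.send[OF \<beta> refl, of b S q "only_channel \<beta> x"] show ?thesis by simp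
qed

subsection \<open>Balanced local runs are executed by rendezvous\<close>

definition local_runs :: "('n \<Rightarrow> 's) \<Rightarrow> ('n \<Rightarrow> 'm act list) \<Rightarrow> ('n \<Rightarrow> 's) \<Rightarrow> bool" where
  "local_runs S \<sigma> S' \<longleftrightarrow> (\<forall>j\<in>pnodes P. local_run (ptrans P j) (S j) (\<sigma> j) (S' j))"

definition balanced :: "('n \<Rightarrow> 'm act list) \<Rightarrow> bool" where
  "balanced \<sigma> \<longleftrightarrow> sends (\<sigma> (ptail P \<beta>)) = []
     \<and> (\<forall>\<xi>\<in>pedges P - {\<beta>}. sends (\<sigma> (ptail P \<xi>)) = recvs (\<sigma> (phead P \<xi>)))"

lemma local_runsD: "local_runs S \<sigma> S' \<Longrightarrow> j \<in> pnodes P \<Longrightarrow> local_run (ptrans P j) (S j) (\<sigma> j) (S' j)"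
  unfolding local_runs_def by blast

lemma local_runs_Nil:
  assumes "local_runs S \<sigma> S'" "\<forall>j\<in>pnodes P. \<sigma> j = []" "S \<in> comp_states P" "S' \<in> comp_states P"
  shows "S = S'"
  using assms unfolding comp_states_def local_runs_def by (intro PiE_ext) auto

lemma local_runs_Cons:
  assumes "local_runs S \<sigma> S'" "j \<in> pnodes P" "\<sigma> j = a # w"
  obtains q where "(S j, a, q) \<in> ptrans P j" "local_runs (S(j := q)) (\<sigma>(j := w)) S'"
proof -
  obtain q where "(S j, a, q) \<in> ptrans P j" "local_run (ptrans P j) q w (S' j)"
    using local_runsD[OF assms(1,2)] assms(3) by auto
  with assms(1) that show thesis unfolding local_runs_def by simp
qed

lemma balanced_starts_with_Rcv:
  assumes bal: "balanced \<sigma>" and "j \<in> pnodes P" "\<sigma> j \<noteq> []"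
  obtains k b w where "k \<in> pnodes P" "\<sigma> k = Rcv b # w"
proof -
  let ?A = "{k \<in> pnodes P. \<sigma> k \<noteq> []}"
  have A: "finite ?A" "?A \<noteq> {}" using finite_nodes assms(2,3) by auto
  then have "Max (depth ` ?A) \<in> depth ` ?A" by simp
  then obtain k where k: "k \<in> ?A" and "depth k = Max (depth ` ?A)" by auto
  then have deepest: "depth i \<le> depth k" if "i \<in> ?A" for i
    using A(1) that by simp
  obtain \<xi> where \<xi>: "\<xi> \<in> pedges P" "ptail P \<xi> = k" using k out_edge by blast
  have "sends (\<sigma> k) = []"
  proof (cases "\<xi> = \<beta>")
    case True
    then show ?thesis using bal \<xi> unfolding balanced_def by simp
  next
    case False
    then have "phead P \<xi> \<notin> ?A" using deepest[of "phead P \<xi>"] depth_head[OF \<xi>(1)] \<xi>(2) by auto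
    then show ?thesis using bal \<xi> False head_node[OF \<xi>(1)] unfolding balanced_def by auto
  qed
  with k starts_with_RcvI that show thesis by blast
qed

lemma balanced_enabled:
  assumes bal: "balanced \<sigma>" and "k \<in> pnodes P" "\<sigma> k = Rcv b # w"
  shows "(\<exists>b w. \<sigma> (phead P \<beta>) = Rcv b # w)
    \<or> (\<exists>\<xi>\<in>pedges P - {\<beta>}. \<exists>b v w. \<sigma> (ptail P \<xi>) = Snd b # v \<and> \<sigma> (phead P \<xi>) = Rcv b # w)"
  using assms(2,3)
proof (induction "depth k" arbitrary: k b w rule: less_induct)
  case less
  obtain \<xi> where \<xi>: "\<xi> \<in> pedges P" "phead P \<xi> = k" using in_edge less.prems(1) by blast
  show ?case
  proof (cases "\<xi> = \<beta>")
    case True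
    then show ?thesis using \<xi>(2) less.prems(2) by blast
  next
    case False
    have sends: "sends (\<sigma> (ptail P \<xi>)) = b # recvs w"
      using bal \<xi> False less.prems(2) unfolding balanced_def by auto
    show ?thesis
    proof (cases "\<exists>b v. \<sigma> (ptail P \<xi>) = Rcv b # v")
      case True
      then show ?thesis using less.hyps depth_head[OF \<xi>(1) False] \<xi> tail_node by (metis lessI)
    next
      case rcv: False
      with sends obtain v where "\<sigma> (ptail P \<xi>) = Snd b # v"
        using starts_with_SndI[of "\<sigma> (ptail P \<xi>)"] by fastforce
      then show ?thesis using \<xi> False less.prems(2) by blast
    qed
  qed
qed

lemma balanced_deliver:
  assumes "balanced \<sigma>" "\<sigma> (phead P \<beta>) = Rcv b # w"
  shows "balanced (\<sigma>(phead P \<beta> := w))"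
proof -
  have "sends ((\<sigma>(phead P \<beta> := w)) j) = sends (\<sigma> j)" for j by (simp add: assms(2))
  moreover have "recvs ((\<sigma>(phead P \<beta> := w)) (phead P \<xi>)) = recvs (\<sigma> (phead P \<xi>))"
    if "\<xi> \<in> pedges P - {\<beta>}" for \<xi>
    using that head_eq_iff \<beta> by simp
  ultimately show ?thesis using assms(1) unfolding balanced_def by simp
qed

lemma balanced_rendezvous:
  assumes "balanced \<sigma>" and \<xi>: "\<xi> \<in> pedges P" "\<xi> \<noteq> \<beta>"
    and w: "\<sigma> (ptail P \<xi>) = Snd b # v" "\<sigma> (phead P \<xi>) = Rcv b # w"
  shows "balanced (\<sigma>(ptail P \<xi> := v, phead P \<xi> := w))" (is "balanced ?\<sigma>")
proof -
  have sends: "sends (?\<sigma> j) = (if j = ptail P \<xi> then sends v else sends (\<sigma> j))" for j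
    using w tail_neq_head[OF \<xi>] by simp
  have recvs: "recvs (?\<sigma> j) = (if j = phead P \<xi> then recvs w else recvs (\<sigma> j))" for j
    using w tail_neq_head[OF \<xi>] by simp
  have bal: "sends (\<sigma> (ptail P \<eta>)) = recvs (\<sigma> (phead P \<eta>))" if "\<eta> \<in> pedges P" "\<eta> \<noteq> \<beta>" for \<eta>
    using assms(1) that unfolding balanced_def by simp
  have "sends (\<sigma> (ptail P \<beta>)) = []" using assms(1) unfolding balanced_def by simp
  moreover have "sends v = recvs w" using bal[OF \<xi>] w by simp
  ultimately show ?thesis
    unfolding balanced_def sends recvs using bal \<xi> \<beta> by (simp add: tail_eq_iff head_eq_iff)
qed

definition total_length :: "('n \<Rightarrow> 'm act list) \<Rightarrow> nat" where
  "total_length \<sigma> = (\<Sum>j\<in>pnodes P. length (\<sigma> j))"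

lemma total_length_less:
  assumes "\<And>j. j \<in> pnodes P \<Longrightarrow> length (\<tau> j) \<le> length (\<sigma> j)"
    and "i \<in> pnodes P" "length (\<tau> i) < length (\<sigma> i)"
  shows "total_length \<tau> < total_length \<sigma>"
  unfolding total_length_def using finite_nodes assms by (intro sum_strict_mono_ex1) auto

lemma balanced_runs_deliver:
  assumes runs: "local_runs S \<sigma> S'" and bal: "balanced \<sigma>" and w: "\<sigma> (phead P \<beta>) = Rcv b # w"
  obtains q where "can_recv P S \<beta> b q"
    and "local_runs (S(phead P \<beta> := q)) (\<sigma>(phead P \<beta> := w)) S'"
    and "balanced (\<sigma>(phead P \<beta> := w))" "total_length (\<sigma>(phead P \<beta> := w)) < total_length \<sigma>"
proof -
  have "total_length (\<sigma>(phead P \<beta> := w)) < total_length \<sigma>"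
    by (rule total_length_less[OF _ head_node[OF \<beta>]]) (simp_all add: w)
  with local_runs_Cons[OF runs head_node[OF \<beta>] w] balanced_deliver[OF bal w] that
  show thesis by blast
qed

lemma balanced_runs_rendezvous:
  assumes runs: "local_runs S \<sigma> S'" and bal: "balanced \<sigma>" and \<xi>: "\<xi> \<in> pedges P" "\<xi> \<noteq> \<beta>"
    and v: "\<sigma> (ptail P \<xi>) = Snd b # v" and w: "\<sigma> (phead P \<xi>) = Rcv b # w"
  obtains p q where "can_send P S \<xi> b p" "can_recv P S \<xi> b q"
    and "local_runs (S(ptail P \<xi> := p, phead P \<xi> := q)) (\<sigma>(ptail P \<xi> := v, phead P \<xi> := w)) S'"
    and "balanced (\<sigma>(ptail P \<xi> := v, phead P \<xi> := w))"
    and "total_length (\<sigma>(ptail P \<xi> := v, phead P \<xi> := w)) < total_length \<sigma>"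
proof -
  obtain p where p: "can_send P S \<xi> b p"
    and "local_runs (S(ptail P \<xi> := p)) (\<sigma>(ptail P \<xi> := v)) S'"
    using local_runs_Cons[OF runs tail_node[OF \<xi>(1)] v] .
  moreover have "(\<sigma>(ptail P \<xi> := v)) (phead P \<xi>) = Rcv b # w" using w tail_neq_head[OF \<xi>] by simp
  ultimately obtain q where "can_recv P S \<xi> b q"
    and "local_runs (S(ptail P \<xi> := p, phead P \<xi> := q)) (\<sigma>(ptail P \<xi> := v, phead P \<xi> := w)) S'"
    using local_runs_Cons[OF _ head_node[OF \<xi>(1)]] tail_neq_head[OF \<xi>] by (metis fun_upd_apply)
  moreover have "total_length (\<sigma>(ptail P \<xi> := v, phead P \<xi> := w)) < total_length \<sigma>"
    by (rule total_length_less[OF _ head_node[OF \<xi>(1)]]) (simp_all add: v w)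
  ultimately show thesis using that p balanced_rendezvous[OF bal \<xi> v w] by blast
qed

lemma sync_balanced_runs:
  assumes "local_runs S \<sigma> S'" "balanced \<sigma>" "S \<in> comp_states P" "S' \<in> comp_states P"
  shows "sync P \<beta> S (recvs (\<sigma> (phead P \<beta>))) S'"
  using assms
proof (induction "total_length \<sigma>" arbitrary: \<sigma> S rule: less_induct)
  case less
  show ?case
  proof (cases "\<forall>j\<in>pnodes P. \<sigma> j = []")
    case True
    then show ?thesis
      using local_runs_Nil[OF less.prems(1) _ less.prems(3,4)] head_node[OF \<beta>] by (simp add: sync.idle)
  next
    case False
    with less.prems(2) obtain k b w where "k \<in> pnodes P" "\<sigma> k = Rcv b # w"
      using balanced_starts_with_Rcv by metis
    from balanced_enabled[OF less.prems(2) this]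
    consider (deliver) b w where "\<sigma> (phead P \<beta>) = Rcv b # w"
      | (rendezvous) \<xi> b v w where "\<xi> \<in> pedges P" "\<xi> \<noteq> \<beta>" "\<sigma> (ptail P \<xi>) = Snd b # v" "\<sigma> (phead P \<xi>) = Rcv b # w"
      by blast
    then show ?thesis
    proof cases
      case deliver
      let ?h = "phead P \<beta>" and ?\<sigma> = "\<sigma>(phead P \<beta> := w)"
      obtain q where q: "can_recv P S \<beta> b q"
        and "total_length ?\<sigma> < total_length \<sigma>" "local_runs (S(?h := q)) ?\<sigma> S'" "balanced ?\<sigma>"
        using balanced_runs_deliver[OF less.prems(1,2) deliver] .
      from less.hyps[OF this(2-) comp_states_upd[OF less.prems(3) head_node[OF \<beta>] q] less.prems(4)]
      have "sync P \<beta> (S(?h := q)) (recvs w) S'" by simp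
      from deliver_sync[OF recv_msg[OF \<beta> q] q this] show ?thesis by (simp add: deliver)
    next
      case rendezvous
      let ?t = "ptail P \<xi>" and ?h = "phead P \<xi>" and ?\<sigma> = "\<sigma>(ptail P \<xi> := v, phead P \<xi> := w)"
      obtain p q where p: "can_send P S \<xi> b p" and q: "can_recv P S \<xi> b q"
        and "total_length ?\<sigma> < total_length \<sigma>" "local_runs (S(?t := p, ?h := q)) ?\<sigma> S'" "balanced ?\<sigma>"
        using balanced_runs_rendezvous[OF less.prems(1,2) rendezvous] .
      from less.hyps[OF this(3-) comp_states_upd[OF comp_states_upd[OF less.prems(3)
          tail_node[OF rendezvous(1)] p] head_node[OF rendezvous(1)] q] less.prems(4)]
      have "sync P \<beta> (S(?t := p, ?h := q)) (recvs (?\<sigma> (phead P \<beta>))) S'" .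
      from rendezvous_sync[OF rendezvous(1,2) recv_msg[OF rendezvous(1) q] p q this] show ?thesis
        using rendezvous(2,3) head_eq_iff[OF \<beta> rendezvous(1)] by (simp split: if_splits)
    qed
  qed
qed

subsection \<open>Executing only what the next output on the cut channel demands\<close>

definition supplied :: "('n \<Rightarrow> 'm act list) \<Rightarrow> bool" where
  "supplied \<sigma> \<longleftrightarrow> (\<forall>\<xi>\<in>pedges P - {\<beta>}. prefix (recvs (\<sigma> (phead P \<xi>))) (sends (\<sigma> (ptail P \<xi>))))"

lemma supplied_butlast:
  assumes "supplied \<tau>" and \<xi>: "\<xi> \<in> pedges P" "\<xi> \<noteq> \<beta>" and w: "\<tau> (ptail P \<xi>) = w @ [a]"
    and superfluous: "(\<exists>b. a = Snd b) \<Longrightarrow> recvs (\<tau> (phead P \<xi>)) \<noteq> sends (\<tau> (ptail P \<xi>))"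
  shows "supplied (\<tau>(ptail P \<xi> := w))"
  unfolding supplied_def
proof
  fix \<eta> assume \<eta>: "\<eta> \<in> pedges P - {\<beta>}"
  let ?\<tau> = "\<tau>(ptail P \<xi> := w)"
  have pre: "prefix (recvs (\<tau> (phead P \<eta>))) (sends (\<tau> (ptail P \<eta>)))"
    using assms(1) \<eta> unfolding supplied_def by blast
  show "prefix (recvs (?\<tau> (phead P \<eta>))) (sends (?\<tau> (ptail P \<eta>)))"
  proof (cases "\<eta> = \<xi>")
    case True
    then show ?thesis
      using pre superfluous w tail_neq_head[OF \<xi>] by (cases a) (auto simp: prefix_snoc)
  next
    case False
    have "prefix (recvs (?\<tau> (phead P \<eta>))) (recvs (\<tau> (phead P \<eta>)))" by (simp add: w)
    moreover have "?\<tau> (ptail P \<eta>) = \<tau> (ptail P \<eta>)"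
      using False tail_eq_iff[of \<eta> \<xi>] \<eta> \<xi>(1) by simp
    ultimately show ?thesis using pre by (auto intro: prefix_order.trans)
  qed
qed

definition supplied_prefixes :: "('n \<Rightarrow> 'm act list) \<Rightarrow> ('n \<Rightarrow> 'm act list) \<Rightarrow> bool" where
  "supplied_prefixes \<sigma> \<tau> \<longleftrightarrow> supplied \<tau> \<and> \<tau> (ptail P \<beta>) = \<sigma> (ptail P \<beta>)
     \<and> (\<forall>j\<in>pnodes P. prefix (\<tau> j) (\<sigma> j))"

lemma shortest_supplied_prefixes_last:
  assumes \<tau>: "is_arg_min total_length (supplied_prefixes \<sigma>) \<tau>"
    and \<xi>: "\<xi> \<in> pedges P" "\<xi> \<noteq> \<beta>" and w: "\<tau> (ptail P \<xi>) = w @ [a]"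
  shows "(\<exists>b. a = Snd b) \<and> recvs (\<tau> (phead P \<xi>)) = sends (\<tau> (ptail P \<xi>))"
proof (rule ccontr)
  assume "\<not> ?thesis"
  have prefixes: "supplied_prefixes \<sigma> \<tau>" using \<tau> unfolding is_arg_min_def by blast
  with \<open>\<not> ?thesis\<close> have "supplied (\<tau>(ptail P \<xi> := w))"
    unfolding supplied_prefixes_def by (intro supplied_butlast[of \<tau>, OF _ \<xi> w]) auto
  moreover have "prefix w (\<sigma> (ptail P \<xi>))"
    using prefixes tail_node[OF \<xi>(1)] w unfolding supplied_prefixes_def by (metis append_prefixD)
  ultimately have "supplied_prefixes \<sigma> (\<tau>(ptail P \<xi> := w))"
    using prefixes \<xi> \<beta> unfolding supplied_prefixes_def by (simp add: tail_eq_iff)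
  moreover have "total_length (\<tau>(ptail P \<xi> := w)) < total_length \<tau>"
    by (rule total_length_less[OF _ tail_node[OF \<xi>(1)]]) (simp_all add: w)
  ultimately show False using \<tau> unfolding is_arg_min_def by blast
qed

lemma demanded_prefixes:
  assumes "supplied \<sigma>"
  obtains \<tau> where "\<And>j. j \<in> pnodes P \<Longrightarrow> prefix (\<tau> j) (\<sigma> j)" "\<tau> (ptail P \<beta>) = \<sigma> (ptail P \<beta>)"
    and "\<And>\<xi>. \<xi> \<in> pedges P \<Longrightarrow> \<xi> \<noteq> \<beta> \<Longrightarrow> sends (\<tau> (ptail P \<xi>)) = recvs (\<tau> (phead P \<xi>))"
    and "\<And>j w a. j \<in> pnodes P \<Longrightarrow> j \<noteq> ptail P \<beta> \<Longrightarrow> \<tau> j = w @ [a] \<Longrightarrow> \<exists>b. a = Snd b"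
proof -
  have "supplied_prefixes \<sigma> \<sigma>" using assms by (simp add: supplied_prefixes_def)
  then obtain \<tau> where \<tau>: "is_arg_min total_length (supplied_prefixes \<sigma>) \<tau>"
    using ex_has_least_nat[of "supplied_prefixes \<sigma>" \<sigma> total_length]
    unfolding is_arg_min_linorder by blast
  then have prefixes: "supplied_prefixes \<sigma> \<tau>" unfolding is_arg_min_def by blast
  show thesis
  proof (rule that)
    show "\<And>j. j \<in> pnodes P \<Longrightarrow> prefix (\<tau> j) (\<sigma> j)" "\<tau> (ptail P \<beta>) = \<sigma> (ptail P \<beta>)"
      using prefixes unfolding supplied_prefixes_def by simp_all
  next
    fix \<xi> assume \<xi>: "\<xi> \<in> pedges P" "\<xi> \<noteq> \<beta>"
    show "sends (\<tau> (ptail P \<xi>)) = recvs (\<tau> (phead P \<xi>))"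
    proof (cases "\<tau> (ptail P \<xi>)" rule: rev_cases)
      case Nil
      then show ?thesis using prefixes \<xi> unfolding supplied_prefixes_def supplied_def by force
    next
      case (snoc w a)
      then show ?thesis using shortest_supplied_prefixes_last[OF \<tau> \<xi>] by simp
    qed
  next
    fix j w a assume j: "j \<in> pnodes P" "j \<noteq> ptail P \<beta>" "\<tau> j = w @ [a]"
    obtain \<xi> where "\<xi> \<in> pedges P" "ptail P \<xi> = j" using out_edge j(1) .
    then show "\<exists>b. a = Snd b" using shortest_supplied_prefixes_last[OF \<tau>, of \<xi> w a] j by auto
  qed
qed

text \<open>The computation has reached \<open>(S', C)\<close>, but its rendezvous rearrangement only \<open>(S, x)\<close>:
  the local runs \<open>\<sigma>\<close>, which contain no output on \<open>\<beta>\<close>, are still to be executed.\<close>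

definition pending :: "('n \<Rightarrow> 's) \<Rightarrow> 'm list \<Rightarrow> ('n \<Rightarrow> 'm act list)
    \<Rightarrow> ('n \<Rightarrow> 's) \<Rightarrow> ('e \<Rightarrow> 'm list) \<Rightarrow> bool" where
  "pending S x \<sigma> S' C \<longleftrightarrow> local_runs S \<sigma> S'
     \<and> sends (\<sigma> (ptail P \<beta>)) = [] \<and> x = recvs (\<sigma> (phead P \<beta>)) @ C \<beta>
     \<and> (\<forall>\<xi>\<in>pedges P - {\<beta>}. sends (\<sigma> (ptail P \<xi>)) = recvs (\<sigma> (phead P \<xi>)) @ C \<xi>)"

lemma local_runs_snoc:
  assumes "local_runs S \<sigma> S'" "(S' j, a, q) \<in> ptrans P j"
  shows "local_runs S (\<sigma>(j := \<sigma> j @ [a])) (S'(j := q))"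
  using assms unfolding local_runs_def by (auto simp: local_run_append)

lemma pending_send:
  assumes "pending S x \<sigma> S' C" "\<xi> \<in> pedges P" "\<xi> \<noteq> \<beta>" "can_send P S' \<xi> b q"
  shows "pending S x (\<sigma>(ptail P \<xi> := \<sigma> (ptail P \<xi>) @ [Snd b]))
    (S'(ptail P \<xi> := q)) (C(\<xi> := C \<xi> @ [b]))" (is "pending S x ?\<sigma> _ _")
proof -
  have "recvs (?\<sigma> j) = recvs (\<sigma> j)" for j by simp
  moreover have "sends (?\<sigma> (ptail P \<eta>)) =
      (if \<eta> = \<xi> then sends (\<sigma> (ptail P \<eta>)) @ [b] else sends (\<sigma> (ptail P \<eta>)))"
    if "\<eta> \<in> pedges P" for \<eta>
    using that assms(2) by (simp add: tail_eq_iff)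
  ultimately show ?thesis
    using assms \<beta> local_runs_snoc unfolding pending_def by simp
qed

lemma pending_recv:
  assumes "pending S x \<sigma> S' C" "\<xi> \<in> pedges P" "can_recv P S' \<xi> b q"
    and "C \<xi> = b # y"
  shows "pending S x (\<sigma>(phead P \<xi> := \<sigma> (phead P \<xi>) @ [Rcv b])) (S'(phead P \<xi> := q)) (C(\<xi> := y))"
    (is "pending S x ?\<sigma> _ ?C")
proof -
  have "sends (?\<sigma> j) = sends (\<sigma> j)" for j by simp
  moreover have "recvs (?\<sigma> (phead P \<eta>)) @ ?C \<eta> = recvs (\<sigma> (phead P \<eta>)) @ C \<eta>" if "\<eta> \<in> pedges P" for \<eta>
    using that assms(2,4) by (simp add: head_eq_iff)
  ultimately show ?thesis
    using assms \<beta> local_runs_snoc unfolding pending_def by simp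
qed

lemma sync_pending:
  assumes "pending S x \<sigma> S' (only_channel \<beta> y)" "S \<in> comp_states P" "S' \<in> comp_states P"
  obtains u where "sync P \<beta> S u S'" "x = u @ y"
proof -
  have "local_runs S \<sigma> S'" "balanced \<sigma>" "x = recvs (\<sigma> (phead P \<beta>)) @ y"
    using assms(1) unfolding pending_def balanced_def by auto
  then show thesis using sync_balanced_runs assms(2,3) that by blast
qed

lemma local_runs_append:
  assumes "local_runs S \<sigma> S'" "S \<in> comp_states P" "\<And>j. j \<in> pnodes P \<Longrightarrow> \<sigma> j = \<tau> j @ \<rho> j"
  obtains S\<^sub>1 where "S\<^sub>1 \<in> comp_states P" "local_runs S \<tau> S\<^sub>1" "local_runs S\<^sub>1 \<rho> S'"
proof -
  have "\<forall>j\<in>pnodes P. \<exists>r. local_run (ptrans P j) (S j) (\<tau> j) r \<and> local_run (ptrans P j) r (\<rho> j) (S' j)"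
    using assms(1,3) unfolding local_runs_def local_run_append[symmetric] by simp
  then obtain r where r: "\<forall>j\<in>pnodes P. local_run (ptrans P j) (S j) (\<tau> j) (r j)
      \<and> local_run (ptrans P j) (r j) (\<rho> j) (S' j)"
    by metis
  have "r j \<in> pstates P j" if j: "j \<in> pnodes P" for j
    using local_run_closed[OF _ _ trans_subset[OF j]] r assms(2) j unfolding comp_states_def by blast
  with r that[of "restrict r (pnodes P)"] show thesis
    unfolding comp_states_def local_runs_def by simp
qed

lemma sync_demanded:
  assumes pending: "pending S x \<sigma> S' C" and S: "S \<in> Pi\<^sub>E (pnodes P) V"
  obtains S\<^sub>1 u y \<rho> where "sync P \<beta> S u S\<^sub>1" "x = u @ y" "pending S\<^sub>1 y \<rho> S' C" "\<rho> (ptail P \<beta>) = []"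
    and "S\<^sub>1 \<in> comp_states P" "\<forall>j\<in>pnodes P - {ptail P \<beta>}. S\<^sub>1 j \<in> V j"
proof -
  have "supplied \<sigma>" using pending unfolding pending_def supplied_def by simp
  then obtain \<tau> where prefix: "\<And>j. j \<in> pnodes P \<Longrightarrow> prefix (\<tau> j) (\<sigma> j)"
    and tail: "\<tau> (ptail P \<beta>) = \<sigma> (ptail P \<beta>)"
    and bal: "\<And>\<xi>. \<xi> \<in> pedges P \<Longrightarrow> \<xi> \<noteq> \<beta> \<Longrightarrow> sends (\<tau> (ptail P \<xi>)) = recvs (\<tau> (phead P \<xi>))"
    and last: "\<And>j w a. j \<in> pnodes P \<Longrightarrow> j \<noteq> ptail P \<beta> \<Longrightarrow> \<tau> j = w @ [a] \<Longrightarrow> \<exists>b. a = Snd b"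
    by (rule demanded_prefixes) blast
  define \<rho> where "\<rho> j = drop (length (\<tau> j)) (\<sigma> j)" for j
  have split: "\<sigma> j = \<tau> j @ \<rho> j" if "j \<in> pnodes P" for j
    using prefix[OF that] by (auto simp: \<rho>_def prefix_def)
  have \<rho>: "\<rho> (ptail P \<beta>) = []" by (simp add: \<rho>_def tail)
  have comp: "S \<in> comp_states P" using S PiE_V_subset by blast
  obtain S\<^sub>1 where S\<^sub>1: "S\<^sub>1 \<in> comp_states P" and runs: "local_runs S \<tau> S\<^sub>1" "local_runs S\<^sub>1 \<rho> S'"
    using pending comp split unfolding pending_def by (blast elim: local_runs_append)
  have "balanced \<tau>" using pending bal tail unfolding pending_def balanced_def by simp
  then have "sync P \<beta> S (recvs (\<tau> (phead P \<beta>))) S\<^sub>1" by (rule sync_balanced_runs[OF runs(1) _ comp S\<^sub>1])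
  moreover have "x = recvs (\<tau> (phead P \<beta>)) @ recvs (\<rho> (phead P \<beta>)) @ C \<beta>"
    using pending split[OF head_node[OF \<beta>]] unfolding pending_def by simp
  moreover have "pending S\<^sub>1 (recvs (\<rho> (phead P \<beta>)) @ C \<beta>) \<rho> S' C"
    using pending runs(2) \<rho> bal split tail_node head_node unfolding pending_def by simp
  moreover have "S\<^sub>1 j \<in> V j" if j: "j \<in> pnodes P" "j \<noteq> ptail P \<beta>" for j
  proof (cases "\<tau> j" rule: rev_cases)
    case Nil
    then show ?thesis using local_runsD[OF runs(1) j(1)] PiE_mem[OF S j(1)] by simp
  next
    case (snoc w a)
    with last[OF j] obtain b r where "(r, Snd b, S\<^sub>1 j) \<in> ptrans P j"
      using local_runsD[OF runs(1) j(1)] by (auto simp: local_run_append)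
    then show ?thesis by (rule send_in_V[OF j(1)])
  qed
  ultimately show thesis using that \<rho> S\<^sub>1 by blast
qed

lemma pending_emit:
  assumes pending: "pending S x \<sigma> S' C" and S: "S \<in> Pi\<^sub>E (pnodes P) V"
    and b: "b \<in> pmsgs P \<beta>" and q: "can_send P S' \<beta> b q"
  obtains S\<^sub>1 u y \<rho> S\<^sub>2 where "sync P \<beta> S u S\<^sub>1" "x = u @ y" "emits P \<beta> S\<^sub>1 b S\<^sub>2" "S\<^sub>2 \<in> Pi\<^sub>E (pnodes P) V"
    and "pending S\<^sub>2 (y @ [b]) \<rho> (S'(ptail P \<beta> := q)) (C(\<beta> := C \<beta> @ [b]))"
proof -
  let ?t = "ptail P \<beta>"
  note t = tail_node[OF \<beta>]
  obtain S\<^sub>1 u y \<rho> where sync: "sync P \<beta> S u S\<^sub>1" "x = u @ y" and pend: "pending S\<^sub>1 y \<rho> S' C"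
    and \<rho>: "\<rho> ?t = []" and S\<^sub>1: "S\<^sub>1 \<in> comp_states P" "\<forall>j\<in>pnodes P - {?t}. S\<^sub>1 j \<in> V j"
    by (rule sync_demanded[OF pending S]) blast
  have runs: "local_runs S\<^sub>1 \<rho> S'" using pend unfolding pending_def by simp
  with \<rho> have "S\<^sub>1 ?t = S' ?t" using local_runsD[OF _ t] by fastforce
  then have "emits P \<beta> S\<^sub>1 b (S\<^sub>1(?t := q))" using b q unfolding emits_def by auto
  moreover have "S\<^sub>1(?t := q) \<in> Pi\<^sub>E (pnodes P) V"
    using S\<^sub>1 send_in_V[OF t q] t unfolding comp_states_def by (auto simp: PiE_iff extensional_def)
  moreover have "local_runs (S\<^sub>1(?t := q)) \<rho> (S'(?t := q))"
    using runs \<rho> unfolding local_runs_def by simp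
  then have "pending (S\<^sub>1(?t := q)) (y @ [b]) \<rho> (S'(?t := q)) (C(\<beta> := C \<beta> @ [b]))"
    using pend \<rho> unfolding pending_def by simp
  ultimately show thesis using that sync by blast
qed

subsection \<open>The least consistent extension\<close>

lemma pending_step:
  assumes closed: "emission_closed P \<beta> V Q" and S: "S \<in> Pi\<^sub>E (pnodes P) V" "x \<in> Q S"
    and pending: "pending S x \<sigma> T D" and step: "step P (T, D) (T', D')"
  shows "\<exists>S'\<in>Pi\<^sub>E (pnodes P) V. \<exists>x'\<in>Q S'. \<exists>\<sigma>'. pending S' x' \<sigma>' T' D'"
  using step
proof cases
  case (send \<xi> i b q)
  show ?thesis
  proof (cases "\<xi> = \<beta>")
    case True
    have "b \<in> pmsgs P \<beta>" "can_send P T \<beta> b q" using send True by simp_all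
    then obtain S\<^sub>1 u y \<rho> S' where "sync P \<beta> S u S\<^sub>1" "x = u @ y" "emits P \<beta> S\<^sub>1 b S'"
      "S' \<in> Pi\<^sub>E (pnodes P) V"
      and "pending S' (y @ [b]) \<rho> (T(ptail P \<beta> := q)) (D(\<beta> := D \<beta> @ [b]))"
      by (rule pending_emit[OF pending S(1)])
    moreover from this have "y @ [b] \<in> Q S'"
      using closed drainI[of S P V \<beta> u S\<^sub>1 y Q] S unfolding emission_closed_def by blast
    ultimately show ?thesis using send True by blast
  next
    case False
    then show ?thesis using pending_send[OF pending] send S by blast
  qed
next
  case (recv \<xi> i b q w)
  then show ?thesis using pending_recv[OF pending] S by blast
qed

lemma pending_of_steps:
  assumes closed: "emission_closed P \<beta> V Q" and S: "S \<in> Pi\<^sub>E (pnodes P) V" "x \<in> Q S"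
    and steps: "(step P)\<^sup>*\<^sup>* (S, only_channel \<beta> x) (T, D)"
  shows "\<exists>S'\<in>Pi\<^sub>E (pnodes P) V. \<exists>x'\<in>Q S'. \<exists>\<sigma>. pending S' x' \<sigma> T D"
  using steps
proof (induction "(T, D)" arbitrary: T D rule: rtranclp_induct)
  case base
  have "pending S x (\<lambda>j. []) S (only_channel \<beta> x)" unfolding pending_def local_runs_def by simp
  with S show ?case by blast
next
  case (step s)
  then show ?case using pending_step[OF closed] by (cases s) blast
qed

lemma drain_of_steps:
  assumes "emission_closed P \<beta> V Q" "S \<in> Pi\<^sub>E (pnodes P) V" "x \<in> Q S"
    and steps: "(step P)\<^sup>*\<^sup>* (S, only_channel \<beta> x) (S', only_channel \<beta> x')"
  shows "x' \<in> drain P \<beta> V Q S'"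
proof -
  obtain S\<^sub>1 x\<^sub>1 \<sigma> where S\<^sub>1: "S\<^sub>1 \<in> Pi\<^sub>E (pnodes P) V" "x\<^sub>1 \<in> Q S\<^sub>1"
    and pend: "pending S\<^sub>1 x\<^sub>1 \<sigma> S' (only_channel \<beta> x')"
    using pending_of_steps[OF assms] by blast
  have "fst (S', only_channel \<beta> x') \<in> comp_states P"
    using steps by (rule rtranclp_induct) (use assms(2) PiE_V_subset step_comp_states in auto)
  then obtain u where "sync P \<beta> S\<^sub>1 u S'" "x\<^sub>1 = u @ x'"
    using sync_pending[OF pend] S\<^sub>1(1) PiE_V_subset by auto
  with S\<^sub>1 show ?thesis by (blast intro: drainI)
qed

lemma drain_comp_states:
  assumes "x \<in> drain P \<beta> V Q S"
  shows "S \<in> comp_states P"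
  using assms by (rule drainE) (use PiE_V_subset sync_comp_states in blast)

lemma drain_subset_extension:
  assumes Q: "is_extension P \<beta> V Q\<^sub>0 Q"
  shows "drain P \<beta> V Q\<^sub>0 S \<subseteq> Q S"
proof
  fix x assume "x \<in> drain P \<beta> V Q\<^sub>0 S"
  then obtain S\<^sub>0 u where S\<^sub>0: "S\<^sub>0 \<in> Pi\<^sub>E (pnodes P) V" "u @ x \<in> Q\<^sub>0 S\<^sub>0" and sync: "sync P \<beta> S\<^sub>0 u S"
    by (rule drainE)
  have "u @ x \<in> Q S\<^sub>0" using Q S\<^sub>0 unfolding is_extension_def by simp
  then show "x \<in> Q S"
    using Q S\<^sub>0(1) PiE_V_subset consistentD[OF _ _ _ sync_steps[OF sync]]
    unfolding is_extension_def by blast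
qed

lemma extension_emission_closed:
  assumes Q: "is_extension P \<beta> V Q\<^sub>0 Q"
  shows "emission_closed P \<beta> V Q\<^sub>0"
  unfolding emission_closed_def
proof (intro allI ballI impI)
  fix S x b S'
  assume x: "x \<in> drain P \<beta> V Q\<^sub>0 S" and S': "S' \<in> Pi\<^sub>E (pnodes P) V" and emits: "emits P \<beta> S b S'"
  obtain S\<^sub>0 u where S\<^sub>0: "S\<^sub>0 \<in> Pi\<^sub>E (pnodes P) V" "u @ x \<in> Q\<^sub>0 S\<^sub>0" and sync: "sync P \<beta> S\<^sub>0 u S"
    using x by (rule drainE)
  have "consistent P \<beta> Q" "u @ x \<in> Q S\<^sub>0" using Q S\<^sub>0 unfolding is_extension_def by simp_all
  moreover have "S\<^sub>0 \<in> comp_states P" using S\<^sub>0(1) PiE_V_subset by blast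
  moreover have "(step P)\<^sup>*\<^sup>* (S\<^sub>0, only_channel \<beta> (u @ x)) (S', only_channel \<beta> (x @ [b]))"
    using sync_steps[OF sync] emits_step[OF emits] by (rule rtranclp.rtrancl_into_rtrancl)
  ultimately have "x @ [b] \<in> Q S'" using consistentD[of P \<beta> Q S\<^sub>0 "u @ x" S' "x @ [b]"] by simp
  then show "x @ [b] \<in> Q\<^sub>0 S'" using Q S' unfolding is_extension_def by simp
qed

lemma consistent_drain:
  assumes "emission_closed P \<beta> V Q\<^sub>0"
  shows "consistent P \<beta> (drain P \<beta> V Q\<^sub>0)"
  unfolding consistent_def
proof (intro allI impI)
  fix S C S' C'
  assume "\<forall>\<xi>. \<xi> \<noteq> \<beta> \<longrightarrow> C \<xi> = []" "\<forall>\<xi>. \<xi> \<noteq> \<beta> \<longrightarrow> C' \<xi> = []" and steps: "(step P)\<^sup>*\<^sup>* (S, C) (S', C')"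
  then have C: "C = only_channel \<beta> (C \<beta>)" "C' = only_channel \<beta> (C' \<beta>)" using eq_only_channel by metis+
  assume "C \<beta> \<in> drain P \<beta> V Q\<^sub>0 S"
  then obtain S\<^sub>0 u where S\<^sub>0: "S\<^sub>0 \<in> Pi\<^sub>E (pnodes P) V" "u @ C \<beta> \<in> Q\<^sub>0 S\<^sub>0" and sync: "sync P \<beta> S\<^sub>0 u S"
    by (rule drainE)
  have "(step P)\<^sup>*\<^sup>* (S\<^sub>0, only_channel \<beta> (u @ C \<beta>)) (S', only_channel \<beta> (C' \<beta>))"
    using rtranclp_trans[OF sync_steps[OF sync]] steps C by metis
  then show "C' \<beta> \<in> drain P \<beta> V Q\<^sub>0 S'" by (rule drain_of_steps[OF assms S\<^sub>0])
qed

lemma drain_is_extension: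
  assumes lists: "\<And>S. S \<in> Pi\<^sub>E (pnodes P) V \<Longrightarrow> Q\<^sub>0 S \<subseteq> lists (pmsgs P \<beta>)"
    and agrees: "\<And>S. S \<in> Pi\<^sub>E (pnodes P) V \<Longrightarrow> drain P \<beta> V Q\<^sub>0 S \<subseteq> Q\<^sub>0 S"
    and closed: "emission_closed P \<beta> V Q\<^sub>0"
  shows "is_extension P \<beta> V Q\<^sub>0 (drain P \<beta> V Q\<^sub>0)"
  unfolding is_extension_def
proof (intro conjI ballI)
  show "drain P \<beta> V Q\<^sub>0 S = Q\<^sub>0 S" if "S \<in> Pi\<^sub>E (pnodes P) V" for S
    using agrees[OF that] subset_drain[OF that] by (rule subset_antisym)
qed (use lists closed in \<open>simp_all add: drain_subset_lists consistent_drain\<close>)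

lemma extension_iff:
  assumes lists: "\<And>S. S \<in> Pi\<^sub>E (pnodes P) V \<Longrightarrow> Q\<^sub>0 S \<subseteq> lists (pmsgs P \<beta>)"
  shows "(\<exists>Q. is_extension P \<beta> V Q\<^sub>0 Q) \<longleftrightarrow>
    (\<forall>S\<in>Pi\<^sub>E (pnodes P) V. drain P \<beta> V Q\<^sub>0 S \<subseteq> Q\<^sub>0 S) \<and> emission_closed P \<beta> V Q\<^sub>0" (is "?L \<longleftrightarrow> ?R")
proof
  assume ?L
  then obtain Q where Q: "is_extension P \<beta> V Q\<^sub>0 Q" ..
  moreover from this have "Q S = Q\<^sub>0 S" if "S \<in> Pi\<^sub>E (pnodes P) V" for S
    using that unfolding is_extension_def by blast
  ultimately show ?R using drain_subset_extension[OF Q] extension_emission_closed[OF Q] by force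
next
  assume ?R
  then have "is_extension P \<beta> V Q\<^sub>0 (drain P \<beta> V Q\<^sub>0)" using lists by (intro drain_is_extension) simp_all
  then show ?L by (rule exI[where x = "drain P \<beta> V Q\<^sub>0"])
qed

lemma smallest_extension_drain:
  assumes "\<And>S. S \<in> Pi\<^sub>E (pnodes P) V \<Longrightarrow> Q\<^sub>0 S \<subseteq> lists (pmsgs P \<beta>)" "is_extension P \<beta> V Q\<^sub>0 Q"
  shows "smallest_extension P \<beta> V Q\<^sub>0 (drain P \<beta> V Q\<^sub>0)"
proof -
  have "\<exists>Q. is_extension P \<beta> V Q\<^sub>0 Q" using assms(2) by (rule exI[where x = Q])
  then have "is_extension P \<beta> V Q\<^sub>0 (drain P \<beta> V Q\<^sub>0)"
    using extension_iff[OF assms(1)] assms(1) by (intro drain_is_extension) simp_all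
  then show ?thesis unfolding smallest_extension_def using drain_subset_extension by blast
qed

end

section \<open>The decision procedure\<close>

definition tail_of :: "proto_code \<Rightarrow> nat \<Rightarrow> nat" where
  "tail_of pc \<xi> = (case map_of (fst (snd pc)) \<xi> of None \<Rightarrow> 0 | Some e \<Rightarrow> fst e)"

definition head_of :: "proto_code \<Rightarrow> nat \<Rightarrow> nat" where
  "head_of pc \<xi> = (case map_of (fst (snd pc)) \<xi> of None \<Rightarrow> 0 | Some e \<Rightarrow> fst (snd e))"

definition msgs_of :: "proto_code \<Rightarrow> nat \<Rightarrow> nat list" where
  "msgs_of pc \<xi> = (case map_of (fst (snd pc)) \<xi> of None \<Rightarrow> [] | Some e \<Rightarrow> snd (snd e))"

definition states_of :: "proto_code \<Rightarrow> nat \<Rightarrow> nat list" where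
  "states_of pc j = (case map_of (snd (snd pc)) j of None \<Rightarrow> [] | Some m \<Rightarrow> fst m)"

definition trans_of :: "proto_code \<Rightarrow> nat \<Rightarrow> (nat \<times> bool \<times> nat \<times> nat) list" where
  "trans_of pc j = (case map_of (snd (snd pc)) j of None \<Rightarrow> [] | Some m \<Rightarrow> snd (snd m))"

definition V_of :: "(nat \<times> nat list) list \<Rightarrow> nat \<Rightarrow> nat list" where
  "V_of vs j = (case map_of vs j of None \<Rightarrow> [] | Some l \<Rightarrow> l)"

text \<open>The value \<open>undefined\<close> for missing nodes agrees with \<open>decode_state\<close>; being a fixed number,
  it does not affect computability.\<close>

definition lookup :: "(nat \<times> nat) list \<Rightarrow> nat \<Rightarrow> nat" where
  "lookup k j = (case map_of k j of None \<Rightarrow> undefined | Some s \<Rightarrow> s)"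

definition update :: "(nat \<times> nat) list \<Rightarrow> nat \<Rightarrow> nat \<Rightarrow> (nat \<times> nat) list" where
  "update k j q = map (\<lambda>(i, p). (i, if i = j then q else p)) k"

text \<open>A composite state \<open>S\<close> is coded by listing \<open>(j, S j)\<close> in the given order of the nodes. As a
  node may occur repeatedly in this order, lists of arbitrary choices have to be normalized.\<close>

definition choices :: "('k \<Rightarrow> 'v list) \<Rightarrow> 'k list \<Rightarrow> ('k \<times> 'v) list list" where
  "choices f js = foldr (\<lambda>j ks. concat (map (\<lambda>q. map (\<lambda>k. (j, q) # k) ks) (f j))) js [[]]"

definition comp_codes :: "proto_code \<Rightarrow> (nat \<times> nat) list list" where
  "comp_codes pc =
     map (\<lambda>k. map (\<lambda>j. (j, lookup k j)) (fst pc)) (choices (states_of pc) (fst pc))"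

definition V_codes :: "proto_code \<Rightarrow> (nat \<times> nat list) list \<Rightarrow> (nat \<times> nat) list list" where
  "V_codes pc vs = filter (\<lambda>k. \<forall>j\<in>set (fst pc). lookup k j \<in> set (V_of vs j)) (comp_codes pc)"

definition sends_of :: "proto_code \<Rightarrow> (nat \<times> nat) list \<Rightarrow> nat \<Rightarrow> (nat \<times> nat) list" where
  "sends_of pc k j =
     map (\<lambda>t. snd (snd t)) (filter (\<lambda>(p, s, b, q). s \<and> p = lookup k j) (trans_of pc j))"

definition recvs_of :: "proto_code \<Rightarrow> (nat \<times> nat) list \<Rightarrow> nat \<Rightarrow> (nat \<times> nat) list" where
  "recvs_of pc k j =
     map (\<lambda>t. snd (snd t)) (filter (\<lambda>(p, s, b, q). \<not> s \<and> p = lookup k j) (trans_of pc j))"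

definition given_nfa :: "proto_code \<Rightarrow> family_code \<Rightarrow> (nat \<times> nat) list \<Rightarrow> nat nfa" where
  "given_nfa pc fc k = (case find (\<lambda>d. \<forall>j\<in>set (fst pc). lookup (fst d) j = lookup k j) fc of
     None \<Rightarrow> (0, [], []) | Some d \<Rightarrow> snd d)"

type_synonym input = "proto_code \<times> nat \<times> (nat \<times> nat list) list \<times> family_code"

definition given_nfas :: "input \<Rightarrow> nat nfa list" where
  "given_nfas inp = (case inp of (pc, \<beta>, vs, fc) \<Rightarrow> map (given_nfa pc fc) (V_codes pc vs))"

text \<open>A configuration \<open>(A, k, q)\<close> says that some word leads \<open>A\<close>, the automaton given for some
  composite state \<open>S\<^sub>0\<close>, to \<open>q\<close> and is consumed by a rendezvous computation from \<open>S\<^sub>0\<close> to \<open>k\<close>.\<close>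

type_synonym configuration = "nat nfa \<times> (nat \<times> nat) list \<times> nat"

definition deliveries :: "proto_code \<Rightarrow> nat \<Rightarrow> configuration \<Rightarrow> configuration list" where
  "deliveries pc \<beta> c = (case c of (A, k, q) \<Rightarrow>
     concat (map (\<lambda>(b, p). map (\<lambda>t. (A, update k (head_of pc \<beta>) p, snd (snd t)))
         (filter (\<lambda>t. fst t = q \<and> fst (snd t) = b) (nfa_trans A)))
       (recvs_of pc k (head_of pc \<beta>))))"

definition handovers :: "proto_code \<Rightarrow> nat \<Rightarrow> configuration \<Rightarrow> configuration list" where
  "handovers pc \<beta> c = (case c of (A, k, q) \<Rightarrow>
     concat (map (\<lambda>\<xi>. concat (map (\<lambda>(b, p).
           map (\<lambda>r. (A, update (update k (tail_of pc \<xi>) p) (head_of pc \<xi>) (snd r), q))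
             (filter (\<lambda>r. fst r = b) (recvs_of pc k (head_of pc \<xi>))))
         (sends_of pc k (tail_of pc \<xi>))))
       (filter (\<lambda>\<xi>. \<xi> \<noteq> \<beta>) (map fst (fst (snd pc))))))"

definition all_configurations :: "input \<Rightarrow> configuration list" where
  "all_configurations inp = (case inp of (pc, \<beta>, vs, fc) \<Rightarrow>
     concat (map (\<lambda>A. concat (map (\<lambda>k. map (\<lambda>q. (A, k, q)) (nfa_states A)) (comp_codes pc)))
       (given_nfas inp)))"

definition reachable_configurations :: "input \<Rightarrow> configuration list" where
  "reachable_configurations inp = (case inp of (pc, \<beta>, vs, fc) \<Rightarrow>
     saturate (all_configurations inp) (\<lambda>c. deliveries pc \<beta> c @ handovers pc \<beta> c)
       (map (\<lambda>k. (given_nfa pc fc k, k, nfa_init (given_nfa pc fc k))) (V_codes pc vs)))"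

definition given_accepts :: "input \<Rightarrow> (nat \<times> nat) list \<Rightarrow> (nat nfa \<times> nat \<times> nat) list \<Rightarrow> bool" where
  "given_accepts inp k t = (case inp of (pc, \<beta>, vs, fc) \<Rightarrow>
     accepts_from t (given_nfa pc fc k) (nfa_init (given_nfa pc fc k)))"

definition drain_accepts :: "input \<Rightarrow> (nat \<times> nat) list \<Rightarrow> (nat nfa \<times> nat \<times> nat) list \<Rightarrow> bool" where
  "drain_accepts inp k t \<longleftrightarrow>
     (\<exists>c\<in>set (reachable_configurations inp). fst (snd c) = k \<and> accepts_from t (fst c) (snd (snd c)))"

definition decide_extension :: "input \<Rightarrow> bool" where
  "decide_extension inp = (case inp of (pc, \<beta>, vs, fc) \<Rightarrow>
     \<forall>t\<in>set (transition_monoid (given_nfas inp) (msgs_of pc \<beta>)).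
       (\<forall>k\<in>set (V_codes pc vs). drain_accepts inp k t \<longrightarrow> given_accepts inp k t)
     \<and> (\<forall>k\<in>set (comp_codes pc). drain_accepts inp k t \<longrightarrow>
         (\<forall>(b, q)\<in>set (sends_of pc k (tail_of pc \<beta>)). update k (tail_of pc \<beta>) q \<in> set (V_codes pc vs) \<longrightarrow>
           given_accepts inp (update k (tail_of pc \<beta>) q) (append_letter (given_nfas inp) t b))))"

definition construct_extension :: "input \<Rightarrow> family_code" where
  "construct_extension inp = (case inp of (pc, \<beta>, vs, fc) \<Rightarrow>
     map (\<lambda>k. (k, monoid_nfa (given_nfas inp) (msgs_of pc \<beta>) (drain_accepts inp k))) (comp_codes pc))"

subsection \<open>Computability\<close>

lemma computable_saturate [computable_intros]:
  assumes "computable U" "computable (\<lambda>p. f (fst p) (snd p))" "computable I"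
  shows "computable (\<lambda>x. saturate (U x) (f x) (I x))"
  unfolding saturate_def add_successors_def
  by (intro computable_intros assms(1,3) computable_compose2[OF assms(2)])

lemma computable_nfa_states [computable_intros]: "computable f \<Longrightarrow> computable (\<lambda>x. nfa_states (f x))"
  by (rule computable_compose; (assumption | simp only: nfa_states_def, intro computable_intros))

lemma computable_state_pairs [computable_intros]: "computable f \<Longrightarrow> computable (\<lambda>x. state_pairs (f x))"
  by (rule computable_compose; (assumption | simp only: state_pairs_def, intro computable_intros))

lemma computable_word_relations [computable_intros]:
  "computable f \<Longrightarrow> computable (\<lambda>x. empty_word_relation (f x))"
  "computable f \<Longrightarrow> computable t \<Longrightarrow> computable b \<Longrightarrow> computable (\<lambda>x. append_letter (f x) (t x) (b x))"
  by (rule computable_compose computable_compose3;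
    (assumption | simp only: empty_word_relation_def append_letter_def case_prod_unfold,
      intro computable_intros))+

lemma computable_transition_monoid [computable_intros]:
  "computable f \<Longrightarrow> computable g \<Longrightarrow> computable (\<lambda>x. transition_monoid (f x) (g x))"
  by (rule computable_compose2;
    (assumption | simp only: transition_monoid_def, intro computable_intros))

lemma computable_accepts_from [computable_intros]:
  "computable t \<Longrightarrow> computable a \<Longrightarrow> computable q \<Longrightarrow> computable (\<lambda>x. accepts_from (t x) (a x) (q x))"
  by (rule computable_compose3; (assumption | simp only: accepts_from_def, intro computable_intros))

lemma computable_monoid_nfa [computable_intros]:
  assumes "computable f" "computable g" "computable (\<lambda>p. acc (fst p) (snd p))"
  shows "computable (\<lambda>x. monoid_nfa (f x) (g x) (acc x))"
  unfolding monoid_nfa_def Let_def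
  by (intro computable_intros computable_compose[OF assms(1)] computable_compose[OF assms(2)]
      computable_compose2[OF assms(3)])

lemma computable_codes [computable_intros]:
  "computable f \<Longrightarrow> computable g \<Longrightarrow> computable (\<lambda>x. tail_of (f x) (g x))"
  "computable f \<Longrightarrow> computable g \<Longrightarrow> computable (\<lambda>x. head_of (f x) (g x))"
  "computable f \<Longrightarrow> computable g \<Longrightarrow> computable (\<lambda>x. msgs_of (f x) (g x))"
  "computable f \<Longrightarrow> computable g \<Longrightarrow> computable (\<lambda>x. states_of (f x) (g x))"
  "computable f \<Longrightarrow> computable g \<Longrightarrow> computable (\<lambda>x. trans_of (f x) (g x))"
  "computable h \<Longrightarrow> computable g \<Longrightarrow> computable (\<lambda>x. V_of (h x) (g x))"
  "computable k \<Longrightarrow> computable g \<Longrightarrow> computable (\<lambda>x. lookup (k x) (g x))"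
  by (rule computable_compose2;
    (assumption | simp only: tail_of_def head_of_def msgs_of_def states_of_def trans_of_def
        V_of_def lookup_def,
      intro computable_intros))+

lemma computable_update [computable_intros]:
  "computable k \<Longrightarrow> computable g \<Longrightarrow> computable h \<Longrightarrow> computable (\<lambda>x. update (k x) (g x) (h x))"
  by (rule computable_compose3;
    (assumption | simp only: update_def case_prod_unfold, intro computable_intros))

lemma computable_comp_codes [computable_intros]: "computable f \<Longrightarrow> computable (\<lambda>x. comp_codes (f x))"
  by (rule computable_compose;
    (assumption | simp only: comp_codes_def choices_def, intro computable_intros))

lemma computable_V_codes [computable_intros]:
  "computable f \<Longrightarrow> computable g \<Longrightarrow> computable (\<lambda>x. V_codes (f x) (g x))"
  by (rule computable_compose2; (assumption | simp only: V_codes_def, intro computable_intros))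

lemma computable_local_transitions [computable_intros]:
  "computable f \<Longrightarrow> computable k \<Longrightarrow> computable g \<Longrightarrow> computable (\<lambda>x. sends_of (f x) (k x) (g x))"
  "computable f \<Longrightarrow> computable k \<Longrightarrow> computable g \<Longrightarrow> computable (\<lambda>x. recvs_of (f x) (k x) (g x))"
  by (rule computable_compose3;
    (assumption | simp only: sends_of_def recvs_of_def case_prod_unfold, intro computable_intros))+

lemma computable_given_nfa [computable_intros]:
  "computable f \<Longrightarrow> computable g \<Longrightarrow> computable k \<Longrightarrow> computable (\<lambda>x. given_nfa (f x) (g x) (k x))"
  by (rule computable_compose3; (assumption | simp only: given_nfa_def, intro computable_intros))

lemma computable_given_nfas [computable_intros]: "computable f \<Longrightarrow> computable (\<lambda>x. given_nfas (f x))"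
  by (rule computable_compose;
    (assumption | simp only: given_nfas_def case_prod_unfold, intro computable_intros))

lemma computable_successors [computable_intros]:
  "computable f \<Longrightarrow> computable g \<Longrightarrow> computable c \<Longrightarrow> computable (\<lambda>x. deliveries (f x) (g x) (c x))"
  "computable f \<Longrightarrow> computable g \<Longrightarrow> computable c \<Longrightarrow> computable (\<lambda>x. handovers (f x) (g x) (c x))"
  by (rule computable_compose3;
    (assumption | simp only: deliveries_def handovers_def case_prod_unfold,
      intro computable_intros))+

lemma computable_reachable_configurations [computable_intros]:
  "computable f \<Longrightarrow> computable (\<lambda>x. reachable_configurations (f x))"
  by (rule computable_compose;
    (assumption | simp only: reachable_configurations_def all_configurations_def case_prod_unfold,
      intro computable_intros))

lemma computable_acceptance [computable_intros]:
  "computable f \<Longrightarrow> computable k \<Longrightarrow> computable t \<Longrightarrow> computable (\<lambda>x. given_accepts (f x) (k x) (t x))"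
  "computable f \<Longrightarrow> computable k \<Longrightarrow> computable t \<Longrightarrow> computable (\<lambda>x. drain_accepts (f x) (k x) (t x))"
  by (rule computable_compose3;
    (assumption | simp only: given_accepts_def drain_accepts_def case_prod_unfold,
      intro computable_intros))+

lemma computable_decide_extension: "computable decide_extension"
  unfolding decide_extension_def case_prod_unfold by (intro computable_intros)

lemma computable_construct_extension: "computable construct_extension"
  unfolding construct_extension_def case_prod_unfold by (intro computable_intros)

lemma enc_family_eq_encode: "enc_family out = encode out"
  unfolding enc_family_def enc_nfa_def encode_list_def encode_prod_def encode_nat_def
  by (auto simp: encode_list_def encode_prod_def encode_nat_def case_prod_unfold comp_def
      intro!: arg_cong[of _ _ list_encode] map_cong)

lemma map_encode_nat: "map encode (ns :: nat list) = ns"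
  by (simp add: encode_nat_def map_idI)

lemma enc_input_eq_encode: "enc_input pc \<beta> vs fc = encode (pc, \<beta>, vs, fc)"
  unfolding enc_input_def enc_family_eq_encode enc_protocol_def enc_V_def
  by (auto simp: encode_list_def encode_prod_def encode_nat_def encode_bool_def map_encode_nat
      case_prod_unfold comp_def
      intro!: arg_cong[of _ _ list_encode] arg_cong[of _ _ prod_encode] map_cong)

section \<open>Correctness of the decision procedure\<close>

lemma decode_protocol_simps:
  "pnodes (decode_protocol pc) = set (fst pc)"
  "pedges (decode_protocol pc) = fst ` set (fst (snd pc))"
  "ptail (decode_protocol pc) = tail_of pc"
  "phead (decode_protocol pc) = head_of pc"
  "pmsgs (decode_protocol pc) \<xi> = set (msgs_of pc \<xi>)"
  "pstates (decode_protocol pc) j = set (states_of pc j)"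
  "ptrans (decode_protocol pc) j =
     (\<lambda>(p, s, b, q). (p, if s then Snd b else Rcv b, q)) ` set (trans_of pc j)"
  by (cases pc; simp add: decode_protocol_def tail_of_def head_of_def msgs_of_def states_of_def
      trans_of_def fun_eq_iff split: option.split)+

lemma set_sends_of:
  "(b, q) \<in> set (sends_of pc k j) \<longleftrightarrow> (lookup k j, Snd b, q) \<in> ptrans (decode_protocol pc) j"
  by (force simp: sends_of_def decode_protocol_simps split: if_splits)

lemma set_recvs_of:
  "(b, q) \<in> set (recvs_of pc k j) \<longleftrightarrow> (lookup k j, Rcv b, q) \<in> ptrans (decode_protocol pc) j"
  by (force simp: recvs_of_def decode_protocol_simps split: if_splits)

lemma decode_V_eq: "decode_V vs j = set (V_of vs j)"
  by (simp add: decode_V_def V_of_def split: option.split)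

lemma decode_state_eq: "decode_state N k j = (if j \<in> N then lookup k j else undefined)"
  by (simp add: decode_state_def lookup_def split: option.split)

lemma lookup_map: "j \<in> set ns \<Longrightarrow> lookup (map (\<lambda>j. (j, f j)) ns) j = f j"
  by (simp add: lookup_def map_of_map_restrict)

lemma update_map: "update (map (\<lambda>j. (j, f j)) ns) i q = map (\<lambda>j. (j, (f(i := q)) j)) ns"
  by (simp add: update_def)

lemma lookup_choice:
  assumes "k \<in> set (choices f js)" "j \<in> set js"
  shows "lookup k j \<in> set (f j)"
  using assms unfolding choices_def by (induction js arbitrary: k) (auto simp: lookup_def)

lemma map_in_choices:
  assumes "\<And>j. j \<in> set js \<Longrightarrow> S j \<in> set (f j)"
  shows "map (\<lambda>j. (j, S j)) js \<in> set (choices f js)"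
  using assms unfolding choices_def by (induction js) auto

lemma set_deliveries:
  "set (deliveries pc \<beta> (A, k, q)) =
     {(A, update k (head_of pc \<beta>) p, r) | b p r.
        (b, p) \<in> set (recvs_of pc k (head_of pc \<beta>)) \<and> (q, b, r) \<in> set (nfa_trans A)}"
  unfolding deliveries_def by force

lemma set_handovers:
  "set (handovers pc \<beta> (A, k, q)) =
     {(A, update (update k (tail_of pc \<xi>) p) (head_of pc \<xi>) p', q) | \<xi> b p p'.
        \<xi> \<in> fst ` set (fst (snd pc)) \<and> \<xi> \<noteq> \<beta> \<and> (b, p) \<in> set (sends_of pc k (tail_of pc \<xi>))
        \<and> (b, p') \<in> set (recvs_of pc k (head_of pc \<xi>))}"
  unfolding handovers_def by force

locale valid_input =
  fixes pc :: proto_code and \<beta> vs fc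
  assumes valid: "valid_instance pc \<beta> vs fc"
begin

abbreviation "P \<equiv> decode_protocol pc"
abbreviation "N \<equiv> pnodes P"
abbreviation "V \<equiv> decode_V vs"
abbreviation "Q\<^sub>0 \<equiv> decode_family N fc"
abbreviation "inp \<equiv> (pc, \<beta>, vs, fc)"
abbreviation "As \<equiv> given_nfas inp"

sublocale cyclic_protocol P \<beta> V
  using valid unfolding valid_instance_def by unfold_locales (auto simp: Let_def)

lemma Q0_subset_lists: "S \<in> Pi\<^sub>E N V \<Longrightarrow> Q\<^sub>0 S \<subseteq> lists (pmsgs P \<beta>)"
  using valid unfolding valid_instance_def by (auto simp: Let_def decode_protocol_simps(1))

definition code :: "(nat \<Rightarrow> nat) \<Rightarrow> (nat \<times> nat) list" where
  "code S = map (\<lambda>j. (j, S j)) (fst pc)"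

lemma lookup_code: "j \<in> N \<Longrightarrow> lookup (code S) j = S j"
  by (simp add: code_def lookup_map decode_protocol_simps)

lemma update_code: "update (code S) j q = code (S(j := q))"
  unfolding code_def by (rule update_map)

lemma decode_code: "S \<in> comp_states P \<Longrightarrow> decode_state N (code S) = S"
  by (rule ext) (auto simp: decode_state_eq lookup_code decode_protocol_simps comp_states_def
      PiE_iff extensional_def)

lemma code_eq_iff: "S \<in> comp_states P \<Longrightarrow> S' \<in> comp_states P \<Longrightarrow> code S = code S' \<longleftrightarrow> S = S'"
  using decode_code by metis

lemma set_comp_codes: "set (comp_codes pc) = code ` comp_states P"
proof (intro set_eqI iffI)
  fix k assume "k \<in> set (comp_codes pc)"
  then obtain c where c: "c \<in> set (choices (states_of pc) (fst pc))" and k: "k = code (lookup c)"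
    by (auto simp: comp_codes_def code_def)
  have "restrict (lookup c) (set (fst pc)) \<in> comp_states P"
    using lookup_choice[OF c] by (simp add: comp_states_def decode_protocol_simps)
  moreover have "k = code (restrict (lookup c) (set (fst pc)))" by (simp add: k code_def)
  ultimately show "k \<in> code ` comp_states P" by blast
next
  fix k assume "k \<in> code ` comp_states P"
  then obtain S where S: "S \<in> comp_states P" "k = code S" by blast
  then have "code S \<in> set (choices (states_of pc) (fst pc))"
    unfolding code_def by (intro map_in_choices) (auto simp: comp_states_def decode_protocol_simps)
  moreover have "map (\<lambda>j. (j, lookup (code S) j)) (fst pc) = code S"
    by (simp add: code_def lookup_map)
  ultimately show "k \<in> set (comp_codes pc)" unfolding comp_codes_def S(2) by force
qed

lemma set_V_codes: "set (V_codes pc vs) = code ` Pi\<^sub>E N V"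
proof -
  have "(\<forall>j\<in>N. lookup (code S) j \<in> set (V_of vs j)) \<longleftrightarrow> S \<in> Pi\<^sub>E N V"
    if "S \<in> comp_states P" for S
    using that by (auto simp: lookup_code decode_protocol_simps decode_V_eq comp_states_def PiE_iff)
  then show ?thesis
    using PiE_V_subset unfolding V_codes_def decode_protocol_simps(1)[symmetric]
    by (auto simp: set_comp_codes)
qed

lemma code_in_image_iff:
  "S \<in> comp_states P \<Longrightarrow> code S \<in> code ` Pi\<^sub>E N V \<longleftrightarrow> S \<in> Pi\<^sub>E N V"
  using code_eq_iff PiE_V_subset by blast

abbreviation given :: "(nat \<Rightarrow> nat) \<Rightarrow> nat nfa" where
  "given S \<equiv> given_nfa pc fc (code S)"

lemma nfa_lang_given:
  assumes "S \<in> comp_states P"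
  shows "nfa_lang (given S) = Q\<^sub>0 S"
proof -
  have "(\<forall>j\<in>N. lookup k j = lookup (code S) j) \<longleftrightarrow> decode_state N k = S" for k
    by (subst (2) decode_code[OF assms, symmetric]) (auto simp: fun_eq_iff decode_state_eq)
  then show ?thesis
    unfolding decode_family_def given_nfa_def decode_protocol_simps(1)
    by (auto simp: nfa_lang_def split: option.split)
qed

lemma set_given_nfas: "set As = given ` Pi\<^sub>E N V"
  by (simp add: given_nfas_def set_V_codes image_image)

lemma given_accepts_iff:
  assumes "S \<in> Pi\<^sub>E N V"
  shows "given_accepts inp (code S) (word_relation As x) \<longleftrightarrow> x \<in> Q\<^sub>0 S"
  using assms PiE_V_subset nfa_lang_given
  by (auto simp: given_accepts_def accepts_from_word_relation set_given_nfas nfa_init_in_states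
      nfa_lang_iff[symmetric])

lemma deliveries_code:
  "set (deliveries pc \<beta> (A, code S, q)) =
     {(A, code (S(phead P \<beta> := p)), r) | b p r. can_recv P S \<beta> b p \<and> (q, b, r) \<in> set (nfa_trans A)}"
  using lookup_code[OF head_node[OF \<beta>]]
  by (simp add: set_deliveries set_recvs_of update_code decode_protocol_simps(4))

lemma handovers_code:
  "set (handovers pc \<beta> (A, code S, q)) =
     {(A, code (S(ptail P \<xi> := p, phead P \<xi> := p')), q) | \<xi> b p p'. \<xi> \<in> pedges P \<and> \<xi> \<noteq> \<beta>
        \<and> can_send P S \<xi> b p \<and> can_recv P S \<xi> b p'}"
proof -
  have "lookup (code S) (tail_of pc \<xi>) = S (tail_of pc \<xi>)"
    "lookup (code S) (head_of pc \<xi>) = S (head_of pc \<xi>)"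
    if "\<xi> \<in> fst ` set (fst (snd pc))" for \<xi>
    using that lookup_code tail_node head_node unfolding decode_protocol_simps(2-4) by simp_all
  then show ?thesis
    unfolding set_handovers set_sends_of set_recvs_of update_code decode_protocol_simps(2-4)
    by (simp cong: conj_cong)
qed

lemma set_all_configurations:
  "set (all_configurations inp) =
     {(A, code S, q) | A S q. A \<in> set As \<and> S \<in> comp_states P \<and> q \<in> set (nfa_states A)}"
  unfolding all_configurations_def by (auto simp: set_comp_codes)

lemma all_configurationsI:
  "A \<in> set As \<Longrightarrow> S \<in> comp_states P \<Longrightarrow> q \<in> set (nfa_states A) \<Longrightarrow>
    (A, code S, q) \<in> set (all_configurations inp)"
  unfolding set_all_configurations by blast

lemma successors_in_all_configurations:
  assumes "c \<in> set (all_configurations inp)"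
  shows "set (deliveries pc \<beta> c @ handovers pc \<beta> c) \<subseteq> set (all_configurations inp)"
proof -
  obtain A S q where c: "c = (A, code S, q)" and A: "A \<in> set As" "q \<in> set (nfa_states A)"
    and S: "S \<in> comp_states P"
    using assms by (auto simp: set_all_configurations)
  have "S(phead P \<beta> := p) \<in> comp_states P" if "can_recv P S \<beta> b p" for b p
    using comp_states_upd[OF S head_node[OF \<beta>] that] .
  moreover have "S(ptail P \<xi> := p, phead P \<xi> := p') \<in> comp_states P"
    if "\<xi> \<in> pedges P" "can_send P S \<xi> b p" "can_recv P S \<xi> b p'" for \<xi> b p p'
    using comp_states_upd[OF comp_states_upd[OF S tail_node that(2)] head_node that(3)] that(1) by simp
  ultimately show ?thesis
    using A unfolding c set_append deliveries_code handovers_code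
    by (blast intro: all_configurationsI nfa_trans_in_states)
qed

abbreviation reaches :: "configuration \<Rightarrow> configuration \<Rightarrow> bool" where
  "reaches \<equiv> (\<lambda>c c'. c' \<in> set (deliveries pc \<beta> c @ handovers pc \<beta> c))\<^sup>*\<^sup>*"

abbreviation start :: "(nat \<Rightarrow> nat) \<Rightarrow> configuration" where
  "start S \<equiv> (given S, code S, nfa_init (given S))"

lemma reaches_imp_sync:
  assumes "reaches (start S\<^sub>0) c"
  shows "\<exists>u S q. c = (given S\<^sub>0, code S, q) \<and> sync P \<beta> S\<^sub>0 u S \<and> nfa_run (given S\<^sub>0) u q"
  using assms
proof (induction rule: rtranclp_induct)
  case base
  show ?case
    by (rule exI[of _ "[]"], rule exI[of _ S\<^sub>0], rule exI[of _ "nfa_init (given S\<^sub>0)"])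
      (simp add: sync.idle)
next
  case (step c c')
  then obtain u S q where c: "c = (given S\<^sub>0, code S, q)" and sync: "sync P \<beta> S\<^sub>0 u S"
    and path: "nfa_run (given S\<^sub>0) u q"
    by blast
  from step.hyps(2) consider (delivery) "c' \<in> set (deliveries pc \<beta> c)"
    | (handover) "c' \<in> set (handovers pc \<beta> c)" by auto
  then show ?case
  proof cases
    case delivery
    then obtain b p r where c': "c' = (given S\<^sub>0, code (S(phead P \<beta> := p)), r)"
      and p: "can_recv P S \<beta> b p" and r: "(q, b, r) \<in> set (nfa_trans (given S\<^sub>0))"
      unfolding c deliveries_code by blast
    have "nfa_run (given S\<^sub>0) (u @ [b]) r"
      using path r by (auto simp: nfa_path_append)
    with c' sync.deliver[OF sync recv_msg[OF \<beta> p] p] show ?thesis by blast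
  next
    case handover
    then obtain \<xi> b p p' where c': "c' = (given S\<^sub>0, code (S(ptail P \<xi> := p, phead P \<xi> := p')), q)"
      and \<xi>: "\<xi> \<in> pedges P" "\<xi> \<noteq> \<beta>" and p: "can_send P S \<xi> b p" and p': "can_recv P S \<xi> b p'"
      unfolding c handovers_code by blast
    with path sync.rendezvous[OF sync \<xi> send_msg[OF \<xi>(1) p] p p'] show ?thesis by blast
  qed
qed

lemma sync_imp_reaches:
  assumes "sync P \<beta> S\<^sub>0 u S" "nfa_run (given S\<^sub>0) u q"
  shows "reaches (start S\<^sub>0) (given S\<^sub>0, code S, q)"
  using assms
proof (induction arbitrary: q)
  case (idle S)
  then show ?case by simp
next
  case (deliver S\<^sub>0 u S b p)
  then obtain r where "nfa_run (given S\<^sub>0) u r" and r: "(r, b, q) \<in> set (nfa_trans (given S\<^sub>0))"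
    by (auto simp: nfa_path_append)
  from deliver.IH[OF this(1)] show ?case
    by (rule rtranclp.rtrancl_into_rtrancl)
      (unfold set_append deliveries_code, use deliver.hyps(3) r in blast)
next
  case (rendezvous S\<^sub>0 u S \<xi> b p p')
  from rendezvous.IH[OF rendezvous.prems] show ?case
    by (rule rtranclp.rtrancl_into_rtrancl)
      (unfold set_append handovers_code, use rendezvous.hyps in blast)
qed

lemma set_reachable_configurations:
  "set (reachable_configurations inp) = {(given S\<^sub>0, code S, q) | S\<^sub>0 u S q.
     S\<^sub>0 \<in> Pi\<^sub>E N V \<and> sync P \<beta> S\<^sub>0 u S \<and> nfa_run (given S\<^sub>0) u q}"
  (is "_ = ?R")
proof -
  let ?I = "map (\<lambda>k. (given_nfa pc fc k, k, nfa_init (given_nfa pc fc k))) (V_codes pc vs)"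
  have I: "set ?I = start ` Pi\<^sub>E N V" by (simp add: set_V_codes image_image)
  have "start S \<in> set (all_configurations inp)" if "S \<in> Pi\<^sub>E N V" for S
    using that PiE_V_subset by (intro all_configurationsI nfa_init_in_states) (auto simp: set_given_nfas)
  then have "set ?I \<subseteq> set (all_configurations inp)" unfolding I by blast
  then have "set (reachable_configurations inp) = {c. \<exists>c\<^sub>0\<in>set ?I. reaches c\<^sub>0 c}"
    unfolding reachable_configurations_def prod.case
    by (intro set_saturate successors_in_all_configurations)
  then have reachable: "c \<in> set (reachable_configurations inp) \<longleftrightarrow>
      (\<exists>S\<^sub>0\<in>Pi\<^sub>E N V. reaches (start S\<^sub>0) c)" for c
    unfolding I by simp
  show ?thesis
  proof (intro set_eqI iffI)
    fix c
    assume "c \<in> set (reachable_configurations inp)"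
    then obtain S\<^sub>0 where "S\<^sub>0 \<in> Pi\<^sub>E N V" "reaches (start S\<^sub>0) c" unfolding reachable by blast
    with reaches_imp_sync[OF this(2)] show "c \<in> ?R" by blast
  next
    fix c
    assume "c \<in> ?R"
    then show "c \<in> set (reachable_configurations inp)"
      unfolding reachable using sync_imp_reaches by blast
  qed
qed

lemma append_in_given_iff:
  assumes "S \<in> Pi\<^sub>E N V"
  shows "u @ x \<in> Q\<^sub>0 S \<longleftrightarrow> (\<exists>q. nfa_run (given S) u q \<and> accepts_from (word_relation As x) (given S) q)"
proof -
  have "accepts_from (word_relation As x) (given S) q \<longleftrightarrow>
      (\<exists>f\<in>set (nfa_finals (given S)). nfa_path (nfa_trans (given S)) q x f)"
    if "nfa_run (given S) u q" for q
    using assms nfa_path_in_states[OF that nfa_init_in_states]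
    by (intro accepts_from_word_relation) (simp_all add: set_given_nfas)
  moreover have "nfa_lang (given S) = Q\<^sub>0 S" using assms PiE_V_subset nfa_lang_given by blast
  then have "u @ x \<in> Q\<^sub>0 S \<longleftrightarrow> (\<exists>f\<in>set (nfa_finals (given S)). nfa_run (given S) (u @ x) f)"
    using nfa_lang_iff[of "u @ x" "given S"] by simp
  ultimately show ?thesis unfolding nfa_path_append by blast
qed

lemma drain_accepts_iff:
  assumes S: "S \<in> comp_states P"
  shows "drain_accepts inp (code S) (word_relation As x) \<longleftrightarrow> x \<in> drain P \<beta> V Q\<^sub>0 S"
proof
  assume "drain_accepts inp (code S) (word_relation As x)"
  then obtain S\<^sub>0 u S' q where S': "code S' = code S"
    and S\<^sub>0: "S\<^sub>0 \<in> Pi\<^sub>E N V" and sync: "sync P \<beta> S\<^sub>0 u S'"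
    and "nfa_run (given S\<^sub>0) u q" "accepts_from (word_relation As x) (given S\<^sub>0) q"
    unfolding drain_accepts_def set_reachable_configurations by force
  then have "u @ x \<in> Q\<^sub>0 S\<^sub>0" unfolding append_in_given_iff[OF S\<^sub>0] by blast
  moreover have "S' = S" using S' S\<^sub>0 sync PiE_V_subset sync_comp_states code_eq_iff[OF _ S] by blast
  ultimately show "x \<in> drain P \<beta> V Q\<^sub>0 S" using S\<^sub>0 sync by (blast intro: drainI)
next
  assume "x \<in> drain P \<beta> V Q\<^sub>0 S"
  then obtain S\<^sub>0 u where S\<^sub>0: "S\<^sub>0 \<in> Pi\<^sub>E N V" "sync P \<beta> S\<^sub>0 u S" and ux: "u @ x \<in> Q\<^sub>0 S\<^sub>0"
    by (rule drainE)
  obtain q where "nfa_run (given S\<^sub>0) u q" and "accepts_from (word_relation As x) (given S\<^sub>0) q"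
    using ux unfolding append_in_given_iff[OF S\<^sub>0(1)] by blast
  moreover from this(1) have "(given S\<^sub>0, code S, q) \<in> set (reachable_configurations inp)"
    using S\<^sub>0 unfolding set_reachable_configurations by blast
  ultimately show "drain_accepts inp (code S) (word_relation As x)"
    unfolding drain_accepts_def by (metis fst_conv snd_conv)
qed

lemma drain_subset_words: "drain P \<beta> V Q\<^sub>0 S \<subseteq> lists (set (msgs_of pc \<beta>))"
  using drain_subset_lists[OF Q0_subset_lists] by (simp add: decode_protocol_simps(5))

lemma emission_closed_iff:
  "emission_closed P \<beta> V Q\<^sub>0 \<longleftrightarrow>
    (\<forall>x\<in>lists (set (msgs_of pc \<beta>)). \<forall>S\<in>comp_states P. x \<in> drain P \<beta> V Q\<^sub>0 S \<longrightarrow>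
      (\<forall>b q. can_send P S \<beta> b q \<longrightarrow> S(ptail P \<beta> := q) \<in> Pi\<^sub>E N V \<longrightarrow>
        x @ [b] \<in> Q\<^sub>0 (S(ptail P \<beta> := q))))"
  using send_msg[OF \<beta>] drain_subset_words drain_comp_states
  unfolding emission_closed_def emits_def by blast

theorem decide_extension_iff: "decide_extension inp \<longleftrightarrow> (\<exists>Q. is_extension P \<beta> V Q\<^sub>0 Q)"
proof -
  let ?M = "set (msgs_of pc \<beta>)" and ?t = "ptail P \<beta>"
  let ?emits_given = "\<lambda>S x. \<forall>b q. can_send P S \<beta> b q \<longrightarrow> S(?t := q) \<in> Pi\<^sub>E N V \<longrightarrow>
      x @ [b] \<in> Q\<^sub>0 (S(?t := q))"
  have emits: "(\<forall>(b, q)\<in>set (sends_of pc (code S) (tail_of pc \<beta>)).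
      update (code S) (tail_of pc \<beta>) q \<in> code ` Pi\<^sub>E N V \<longrightarrow>
      given_accepts inp (update (code S) (tail_of pc \<beta>) q) (append_letter As (word_relation As x) b))
    \<longleftrightarrow> ?emits_given S x" if S: "S \<in> comp_states P" for S x
  proof -
    have "code (S(?t := q)) \<in> code ` Pi\<^sub>E N V \<longleftrightarrow> S(?t := q) \<in> Pi\<^sub>E N V"
      if "can_send P S \<beta> b q" for b q
      by (rule code_in_image_iff, rule comp_states_upd[OF S tail_node[OF \<beta>] that])
    then show ?thesis
      using lookup_code[OF tail_node[OF \<beta>]] unfolding Ball_def split_paired_All prod.case
      by (simp add: set_sends_of update_code decode_protocol_simps(3) given_accepts_iff
          flip: word_relation_snoc cong: imp_cong del: fun_upd_apply)
  qed
  have "decide_extension inp \<longleftrightarrow> (\<forall>x\<in>lists ?M.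
      (\<forall>S\<in>Pi\<^sub>E N V. x \<in> drain P \<beta> V Q\<^sub>0 S \<longrightarrow> x \<in> Q\<^sub>0 S)
    \<and> (\<forall>S\<in>comp_states P. x \<in> drain P \<beta> V Q\<^sub>0 S \<longrightarrow> ?emits_given S x))"
    unfolding decide_extension_def prod.case set_transition_monoid set_comp_codes set_V_codes
    using PiE_V_subset by (simp add: emits drain_accepts_iff given_accepts_iff subset_iff)
  also have "\<dots> \<longleftrightarrow> (\<forall>S\<in>Pi\<^sub>E N V. drain P \<beta> V Q\<^sub>0 S \<subseteq> Q\<^sub>0 S) \<and> emission_closed P \<beta> V Q\<^sub>0"
    using drain_subset_words unfolding emission_closed_iff by blast
  also have "\<dots> \<longleftrightarrow> (\<exists>Q. is_extension P \<beta> V Q\<^sub>0 Q)"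
    by (rule extension_iff[symmetric]) (rule Q0_subset_lists)
  finally show ?thesis .
qed

lemma nfa_lang_drain:
  assumes "S \<in> comp_states P"
  shows "nfa_lang (monoid_nfa As (msgs_of pc \<beta>) (drain_accepts inp (code S))) = drain P \<beta> V Q\<^sub>0 S"
  using drain_subset_words by (auto simp: nfa_lang_monoid_nfa drain_accepts_iff[OF assms])

lemma regular_drain: "S \<in> comp_states P \<Longrightarrow> regular (drain P \<beta> V Q\<^sub>0 S)"
  unfolding regular_def using nfa_lang_drain by blast

lemma covers_construct_extension: "covers N (construct_extension inp) (comp_states P)"
  unfolding covers_def construct_extension_def by (auto simp: set_comp_codes decode_code)

lemma decode_construct_extension:
  assumes S: "S \<in> comp_states P"
  shows "decode_family N (construct_extension inp) S = drain P \<beta> V Q\<^sub>0 S"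
proof -
  have "find (\<lambda>e. decode_state N (fst e) = S) (map (\<lambda>k. (k, f k)) ks) = Some (code S, f (code S))"
    if "code S \<in> set ks" "set ks \<subseteq> code ` comp_states P" for ks and f :: "_ \<Rightarrow> nat nfa"
    using that by (induction ks) (auto simp: decode_code code_eq_iff[OF S])
  then have "decode_family N (construct_extension inp) S =
      nfa_lang (monoid_nfa As (msgs_of pc \<beta>) (drain_accepts inp (code S)))"
    using S unfolding decode_family_def construct_extension_def by (simp add: set_comp_codes)
  then show ?thesis by (simp only: nfa_lang_drain[OF S])
qed

end

theorem theorem8p8:
  shows
  "(\<exists>decider :: recf. \<forall>pc \<beta> vs fc. valid_instance pc \<beta> vs fc \<longrightarrow>
      reval decider [enc_input pc \<beta> vs fc]
        (if (\<exists>Q. is_extension (decode_protocol pc) \<beta> (decode_V vs)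
                   (decode_family (pnodes (decode_protocol pc)) fc) Q) then 1 else 0))
 \<and> (\<exists>constructor :: recf. \<forall>pc \<beta> vs fc.
      valid_instance pc \<beta> vs fc
      \<longrightarrow> (\<exists>Q. is_extension (decode_protocol pc) \<beta> (decode_V vs)
                 (decode_family (pnodes (decode_protocol pc)) fc) Q)
      \<longrightarrow> (\<exists>Qmin. smallest_extension (decode_protocol pc) \<beta> (decode_V vs)
                    (decode_family (pnodes (decode_protocol pc)) fc) Qmin
              \<and> (\<forall>S\<in>comp_states (decode_protocol pc). regular (Qmin S))
              \<and> (\<exists>out. reval constructor [enc_input pc \<beta> vs fc] (enc_family out)
                    \<and> covers (pnodes (decode_protocol pc)) out (comp_states (decode_protocol pc))
                    \<and> (\<forall>S\<in>comp_states (decode_protocol pc).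
                          decode_family (pnodes (decode_protocol pc)) out S = Qmin S))))"
proof -
  obtain d where d: "\<And>inp. reval d [encode inp] (encode (decide_extension inp))"
    using reval_computable[OF computable_decide_extension] by blast
  obtain c where c: "\<And>inp. reval c [encode inp] (encode (construct_extension inp))"
    using reval_computable[OF computable_construct_extension] by blast
  show ?thesis
  proof (rule conjI[OF exI[of _ d] exI[of _ c]]; intro allI impI)
    fix pc \<beta> vs fc
    assume "valid_instance pc \<beta> vs fc"
    then interpret valid_input pc \<beta> vs fc by unfold_locales
    show "reval d [enc_input pc \<beta> vs fc] (if \<exists>Q. is_extension P \<beta> V Q\<^sub>0 Q then 1 else 0)"
      using d[of inp] by (simp add: enc_input_eq_encode decide_extension_iff encode_bool_def of_bool_def)
    assume "\<exists>Q. is_extension P \<beta> V Q\<^sub>0 Q"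
    then have "smallest_extension P \<beta> V Q\<^sub>0 (drain P \<beta> V Q\<^sub>0)"
      using smallest_extension_drain[of Q\<^sub>0] Q0_subset_lists by blast
    moreover have "reval c [enc_input pc \<beta> vs fc] (enc_family (construct_extension inp))"
      using c[of inp] by (simp only: enc_input_eq_encode enc_family_eq_encode)
    ultimately show "\<exists>Qmin. smallest_extension P \<beta> V Q\<^sub>0 Qmin \<and> (\<forall>S\<in>comp_states P. regular (Qmin S))
        \<and> (\<exists>out. reval c [enc_input pc \<beta> vs fc] (enc_family out) \<and> covers N out (comp_states P)
          \<and> (\<forall>S\<in>comp_states P. decode_family N out S = Qmin S))"
      using regular_drain covers_construct_extension decode_construct_extension by blast
  qed
qed

end
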